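(* Let $T>0$ and $1\le p\le\infty$. Let $X^{ant}=\{v\in H^1(0,T): v(0)+v(T)=0\}$ and define $I_p^{ant}:X^{ant}\setminus\{0\}\to\mathbb{R}$ by $$I_1^{ant}(v)=\frac{\int_0^T v'^2}{\|v\|_\infty^2},\qquad I_\infty^{ant}(v)=\frac{\int_0^T v'^2}{\int_0^T v^2},\qquad I_p^{ant}(v)=\frac{\int_0^T v'^2}{\left(\int_0^T|v|^{\frac{2p}{p-1}}\right)^{\frac{p-1}{p}}}\ \text{ if } 1<p<\infty.$$ Then the $L_p$ Lyapunov constant $\beta_p^{ant}$ for the antiperiodic problem satisfies $$\beta_p^{ant}=\min_{X^{ant}\setminus\{0\}} I_p^{ant}$$ (in particular the minimum is attained).
   Context: $L_T(\mathbb{R},\mathbb{R})$ is the set of $T$-periodic functions $a:\mathbb{R}\to\mathbb{R}$ with $a|_{[0,T]}\in L^1(0,T)$. $\Lambda^{ant}$ is the set of $a\in L_T(\mathbb{R},\mathbb{R})$ such that the antiperiodic problem $u''(t)+a(t)u(t)=0$, $t\in(0,T)$, $u(0)+u(T)=u'(0)+u'(T)=0$, has nontrivial solutions. For $1\le p\le\infty$, $$\beta_p^{ant}=\inf_{a\in\Lambda^{ant}\cap L^p(0,T)}\|a^+\|_p,$$ where $a^+=\max(a,0)$ and $\|\cdot\|_p$ is the $L^p(0,T)$ norm (essential supremum if $p=\infty$). *)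

theory Defs
  imports "HOL-Probability.Essential_Supremum"
begin

text \<open>Functions on the interval are represented by functions on the whole real line whose values
  outside \<open>[0,T]\<close> are ignored. The endpoints form a null set, so \<open>[0,T]\<close> and \<open>(0,T)\<close> give the
  same \<open>L\<^sup>p\<close> spaces.\<close>

definition Lp_space :: "real \<Rightarrow> ereal \<Rightarrow> (real \<Rightarrow> real) set" where
  "Lp_space T p = {f \<in> borel_measurable (lebesgue_on {0..T}).
     if p = \<infinity> then esssup (lebesgue_on {0..T}) (\<lambda>t. ereal \<bar>f t\<bar>) < \<infinity>
     else integrable (lebesgue_on {0..T}) (\<lambda>t. \<bar>f t\<bar> powr real_of_ereal p)}"

definition Lp_norm :: "real \<Rightarrow> ereal \<Rightarrow> (real \<Rightarrow> real) \<Rightarrow> real" where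
  "Lp_norm T p f =
     (if p = \<infinity> then real_of_ereal (esssup (lebesgue_on {0..T}) (\<lambda>t. ereal \<bar>f t\<bar>))
      else (LINT t|lebesgue_on {0..T}. \<bar>f t\<bar> powr real_of_ereal p) powr (1 / real_of_ereal p))"

definition L_periodic :: "real \<Rightarrow> (real \<Rightarrow> real) set" where
  "L_periodic T = {a. (\<forall>t. a (t + T) = a t) \<and> a \<in> Lp_space T 1}"

definition abs_continuous_on_interval :: "real \<Rightarrow> real \<Rightarrow> (real \<Rightarrow> real) \<Rightarrow> bool" where
  "abs_continuous_on_interval a b f \<longleftrightarrow>
     (\<forall>\<epsilon>>0. \<exists>\<delta>>0. \<forall>D :: (real \<times> real) set.
        finite D \<and> (\<forall>(x, y)\<in>D. a \<le> x \<and> x \<le> y \<and> y \<le> b) \<and>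
        disjoint_family_on (\<lambda>(x, y). {x<..<y}) D \<and> (\<Sum>(x, y)\<in>D. y - x) < \<delta> \<longrightarrow>
        (\<Sum>(x, y)\<in>D. \<bar>f y - f x\<bar>) < \<epsilon>)"

text \<open>Since \<open>a\<close> is only integrable, solutions of \<open>u'' + a u = 0\<close> are understood in the sense of
  Caratheodory: \<open>u\<close> is continuously differentiable on \<open>[0,T]\<close> (one-sidedly at the endpoints), its
  derivative \<open>u'\<close> is absolutely continuous, and the equation holds almost everywhere.\<close>

definition antiperiodic_solution ::
    "real \<Rightarrow> (real \<Rightarrow> real) \<Rightarrow> (real \<Rightarrow> real) \<Rightarrow> bool" where
  "antiperiodic_solution T a u \<longleftrightarrow>
     (\<exists>u'. (\<forall>t\<in>{0..T}. (u has_real_derivative u' t) (at t within {0..T})) \<and>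
           abs_continuous_on_interval 0 T u' \<and>
           (AE t in lebesgue_on {0..T}.
              \<exists>u''. (u' has_real_derivative u'') (at t within {0..T}) \<and> u'' + a t * u t = 0) \<and>
           u 0 + u T = 0 \<and> u' 0 + u' T = 0)"

definition Lambda_ant :: "real \<Rightarrow> (real \<Rightarrow> real) set" where
  "Lambda_ant T =
     {a \<in> L_periodic T. \<exists>u. antiperiodic_solution T a u \<and> (\<exists>t\<in>{0..T}. u t \<noteq> 0)}"

text \<open>The infimum is taken in the extended reals, where the infimum of the empty set is \<open>\<infinity>\<close>.\<close>

definition beta_ant :: "real \<Rightarrow> ereal \<Rightarrow> ereal" where
  "beta_ant T p =
     (INF a \<in> Lambda_ant T \<inter> Lp_space T p. ereal (Lp_norm T p (\<lambda>t. max (a t) 0)))"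

definition test_function :: "real \<Rightarrow> (real \<Rightarrow> real) \<Rightarrow> bool" where
  "test_function T \<phi> \<longleftrightarrow>
     \<phi> C1_differentiable_on UNIV \<and>
     (\<exists>K. compact K \<and> K \<subseteq> {0<..<T} \<and> (\<forall>t. t \<notin> K \<longrightarrow> \<phi> t = 0))"

definition has_weak_derivative :: "real \<Rightarrow> (real \<Rightarrow> real) \<Rightarrow> (real \<Rightarrow> real) \<Rightarrow> bool" where
  "has_weak_derivative T v g \<longleftrightarrow>
     (\<forall>\<phi>. test_function T \<phi> \<longrightarrow>
        (LINT t|lebesgue_on {0..T}. v t * deriv \<phi> t) = - (LINT t|lebesgue_on {0..T}. g t * \<phi> t))"

text \<open>Each class in \<open>H\<^sup>1(0,T)\<close> is represented by its continuous representative on \<open>[0,T]\<close>; this is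
  what gives a meaning to \<open>v 0\<close> and \<open>v T\<close>.\<close>

definition H1 :: "real \<Rightarrow> (real \<Rightarrow> real) set" where
  "H1 T = {v \<in> Lp_space T 2. continuous_on {0..T} v \<and>
             (\<exists>g\<in>Lp_space T 2. has_weak_derivative T v g)}"

text \<open>The weak derivative is unique up to null sets, so integrals do not depend on the choice.\<close>

definition weak_deriv :: "real \<Rightarrow> (real \<Rightarrow> real) \<Rightarrow> real \<Rightarrow> real" where
  "weak_deriv T v = (SOME g. g \<in> Lp_space T 2 \<and> has_weak_derivative T v g)"

definition X_ant :: "real \<Rightarrow> (real \<Rightarrow> real) set" where
  "X_ant T = {v \<in> H1 T. v 0 + v T = 0}"

definition X_ant_nonzero :: "real \<Rightarrow> (real \<Rightarrow> real) set" where
  "X_ant_nonzero T = {v \<in> X_ant T. \<exists>t\<in>{0..T}. v t \<noteq> 0}"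

definition I_ant :: "real \<Rightarrow> ereal \<Rightarrow> (real \<Rightarrow> real) \<Rightarrow> real" where
  "I_ant T p v =
     (LINT t|lebesgue_on {0..T}. (weak_deriv T v t)\<^sup>2) /
     (if p = 1 then (Lp_norm T \<infinity> v)\<^sup>2
      else if p = \<infinity> then (LINT t|lebesgue_on {0..T}. (v t)\<^sup>2)
      else (let q = real_of_ereal p in
             (LINT t|lebesgue_on {0..T}. \<bar>v t\<bar> powr (2 * q / (q - 1))) powr ((q - 1) / q)))"

end

theory Submission
  imports Defs "HOL-Real_Asymp.Real_Asymp"
begin

text \<open>Multiplying \<open>u'' + a u = 0\<close> by \<open>u\<close>, integrating and applying the Hoelder inequality gives
  \<open>I\<^sub>p(u) \<le> \<parallel>a\<^sup>+\<parallel>\<^sub>p\<close> for every solution, hence \<open>\<beta>\<^sub>p \<ge> inf I\<^sub>p\<close>.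

  For \<open>p > 1\<close> put \<open>q = 2p/(p-1)\<close>, so that the denominator of \<open>I\<^sub>p\<close> is the squared \<open>L\<^sup>q\<close> norm, and let \<open>H\<close> be the
  odd antiderivative of \<open>h(s) = sqrt (1 - |s|\<^sup>q)\<close>. If \<open>max |v| = 1\<close>, then \<open>v(0) = -v(T)\<close> yields
  \<open>2 H(1) \<le> \<integral> h(v) |v'|\<close>, and by Cauchy-Schwarz \<open>4 H(1)\<^sup>2 \<le> (T - J) \<integral> v'\<^sup>2\<close> with \<open>J = \<integral> |v|\<^sup>q\<close>. Maximizing
  \<open>(T - J) J\<^bsup>2/q\<^esup>\<close> over \<open>J\<close> gives a lower bound for \<open>I\<^sub>p\<close>, which is attained by the generalized sine
  function \<open>u'\<^sup>2 = \<omega>\<^sup>2 (1 - |u|\<^sup>q)\<close>. This function solves \<open>u'' + a u = 0\<close> with \<open>a = \<kappa> |u|\<^bsup>q-2\<^esup>\<close> and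
  \<open>\<parallel>a\<parallel>\<^sub>p = I\<^sub>p(u)\<close>. For \<open>p = 1\<close> the minimizer is \<open>1 - 2t/T\<close>.\<close>

section \<open>Integration on an interval\<close>

text \<open>The weight \<open>h\<close> comes from the differential equation: multiplying u'' +
  \<kappa> |u|^(q-2) u = 0 by u' gives the first integral u'^2 = \<omega>^2 (1 - |u|^q). Along the
  extremal, |u'| is therefore proportional to h(u), the equality case of Cauchy-Schwarz, and u rises
  once from 0 to 1 and falls back once, the equality case of the variation bound. Its energy is both
  \<kappa> J and \<omega>^2 (T - J); equating the two puts J at the critical point of (T - J)
  J^(2/q). One explicit function thus makes all three estimates sharp, and the minimum is found
  without compactness. The obstacle is regularity. A competitor has only a weak derivative: it
  enters solely through the fact that its integrals are the increments of v, and the chain rule for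
  H(v) is proved as an inequality by bisection. A solution has u'' only almost everywhere: this
  calls for a fundamental theorem of calculus for absolutely continuous functions. As q grows, h
  tends to 1 on (-1,1) and H to the identity, which explains the weight h = 1 for p = 1.\<close>

lemma continuous_on_interval_bounded:
  fixes u :: "real \<Rightarrow> real"
  assumes "continuous_on {a..b} u"
  obtains B where "\<And>t. t \<in> {a..b} \<Longrightarrow> \<bar>u t\<bar> \<le> B"
proof -
  have "bounded (u ` {a..b})" by (intro compact_imp_bounded compact_continuous_image assms) simp
  then obtain B where "\<forall>x\<in>u ` {a..b}. norm x \<le> B" unfolding bounded_iff by blast
  then show thesis by (intro that[of B]) auto
qed

lemma continuous_on_abs_powr:
  fixes w :: "real \<Rightarrow> real"
  assumes "continuous_on A w" "0 < q"
  shows "continuous_on A (\<lambda>t. \<bar>w t\<bar> powr q)"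
  using assms by (intro continuous_on_powr' continuous_intros) auto

lemma lebesgue_integral_FTC:
  fixes F f :: "real \<Rightarrow> real"
  assumes "a \<le> b" "\<And>x. x \<in> {a..b} \<Longrightarrow> (F has_real_derivative f x) (at x within {a..b})"
    and "continuous_on {a..b} f"
  shows "(LINT x|lebesgue_on {a..b}. f x) = F b - F a"
proof -
  have "(f has_integral (F b - F a)) {a..b}"
    by (rule fundamental_theorem_of_calculus)
      (use assms in \<open>auto simp: has_real_derivative_iff_has_vector_derivative\<close>)
  then show ?thesis
    using lebesgue_integral_eq_integral[OF continuous_imp_integrable_real[OF assms(3)]]
    by (simp add: integral_unique)
qed

lemma integrable_continuous_mult:
  fixes f g :: "real \<Rightarrow> real"
  assumes f: "continuous_on {a..b} f" and g: "integrable (lebesgue_on {a..b}) g"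
  shows "integrable (lebesgue_on {a..b}) (\<lambda>x. f x * g x)"
proof (rule absolutely_integrable_imp_integrable)
  show "(\<lambda>x. f x * g x) absolutely_integrable_on {a..b}"
  proof (rule absolutely_integrable_bounded_measurable_product_real)
    show "f \<in> borel_measurable (lebesgue_on {a..b})"
      using f by (rule continuous_imp_measurable_on_sets_lebesgue) auto
    show "bounded (f ` {a..b})"
      by (intro compact_imp_bounded compact_continuous_image f) auto
    show "g absolutely_integrable_on {a..b}"
      using integrable_norm[OF g] g by (simp add: absolutely_integrable_measurable comp_def)
  qed auto
qed auto

text \<open>A gauge that confines the tags in \<open>N\<close> to an open set of small measure leaves those subintervals
  to absolute continuity; this avoids Lebesgue differentiation.\<close>

lemma abs_continuous_has_integral:
  assumes "a \<le> b" and ac: "abs_continuous_on_interval a b f" and N: "N \<in> null_sets lebesgue"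
    and der: "\<And>x. x \<in> {a..b} - N \<Longrightarrow> (f has_real_derivative h x) (at x within {a..b})"
  shows "(h has_integral (f b - f a)) {a..b}"
proof -
  \<comment> \<open>With value 0 on \<open>N\<close>, a tag in \<open>N\<close> contributes nothing
    to the Riemann sum, and only the increment of \<open>f\<close> over its interval has to be
    controlled. The change on a null set is undone at the end.\<close>
  define h0 where "h0 x = (if x \<in> N then 0 else h x)" for x
  have "(h0 has_integral (f b - f a)) {a..b}"
    unfolding has_integral_real
  proof (intro allI impI)
    fix e :: real assume "e > 0"
    define e1 where "e1 = e / (2 * (b - a + 1))"
    have "e1 > 0" using \<open>e > 0\<close> \<open>a \<le> b\<close> by (simp add: e1_def)
    have "\<exists>\<delta>>0. \<forall>D :: (real \<times> real) set.
        finite D \<and> (\<forall>(x, y)\<in>D. a \<le> x \<and> x \<le> y \<and> y \<le> b) \<and>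
        disjoint_family_on (\<lambda>(x, y). {x<..<y}) D \<and> (\<Sum>(x, y)\<in>D. y - x) < \<delta> \<longrightarrow>
        (\<Sum>(x, y)\<in>D. \<bar>f y - f x\<bar>) < e / 2"
      by (rule ac[unfolded abs_continuous_on_interval_def, rule_format, of "e / 2"]) (use \<open>e > 0\<close> in simp)
    then obtain \<delta> where "\<delta> > 0" and \<delta>: "\<And>D :: (real \<times> real) set.
        finite D \<Longrightarrow> \<forall>(x, y)\<in>D. a \<le> x \<and> x \<le> y \<and> y \<le> b \<Longrightarrow>
        disjoint_family_on (\<lambda>(x, y). {x<..<y}) D \<Longrightarrow> (\<Sum>(x, y)\<in>D. y - x) < \<delta> \<Longrightarrow>
        (\<Sum>(x, y)\<in>D. \<bar>f y - f x\<bar>) < e / 2"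
      by blast
    obtain U where U: "open U" "N \<subseteq> U" "(U - N) \<in> lmeasurable"
        "emeasure lebesgue (U - N) < ennreal \<delta>"
      using sets_lebesgue_outer_open[of N \<delta>] N \<open>\<delta> > 0\<close> by auto
    have emU: "emeasure lebesgue U < ennreal \<delta>"
      using U N emeasure_Diff_null_set[OF N, of U] by (simp add: borel_open)
    have "\<forall>x. \<exists>d>0. x \<in> {a..b} - N \<longrightarrow>
         (\<forall>y\<in>{a..b}. norm (y-x) < d \<longrightarrow> norm (f y - f x - (y-x) *\<^sub>R h x) \<le> e1 * norm (y-x))"
    proof
      fix x
      show "\<exists>d>0. x \<in> {a..b} - N \<longrightarrow>
         (\<forall>y\<in>{a..b}. norm (y-x) < d \<longrightarrow> norm (f y - f x - (y-x) *\<^sub>R h x) \<le> e1 * norm (y-x))"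
      proof (cases "x \<in> {a..b} - N")
        case True
        from der[OF this] have "(f has_vector_derivative h x) (at x within {a..b})"
          by (simp add: has_real_derivative_iff_has_vector_derivative)
        then show ?thesis
          using \<open>e1 > 0\<close> unfolding has_vector_derivative_def has_derivative_within_alt by blast
      qed (auto intro: exI[of _ 1])
    qed
    then obtain d where d: "\<And>x. 0 < d x"
      "\<And>x y. \<lbrakk>x \<in> {a..b} - N; y \<in> {a..b}; norm (y-x) < d x\<rbrakk>
              \<Longrightarrow> norm (f y - f x - (y-x) *\<^sub>R h x) \<le> e1 * norm (y-x)"
      by metis
    define \<gamma> where "\<gamma> x = (if x \<in> N then U else ball x (d x))" for x
    have g: "gauge \<gamma>" using U d(1) by (auto simp: gauge_def \<gamma>_def)
    have bound: "norm ((\<Sum>(x, k)\<in>p. measure lborel k *\<^sub>R h0 x) - (f b - f a)) < e"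
      if p: "p tagged_division_of {a..b}" and fine: "\<gamma> fine p" for p
    proof -
      note pD = tagged_division_ofD[OF p]
      have fin: "finite p" by (rule pD)
      have ba: "(\<Sum>(x,K)\<in>p. Sup K - Inf K) = b - a" "(\<Sum>(x,K)\<in>p. f(Sup K) - f(Inf K)) = f b - f a"
        using additive_tagged_division_1[where f= "\<lambda>x. x", OF \<open>a \<le> b\<close> p]
          additive_tagged_division_1[where f= f, OF \<open>a \<le> b\<close> p] by auto
      have K: "\<exists>u v. K = {u..v} \<and> u \<le> v \<and> a \<le> u \<and> v \<le> b \<and> u \<le> x \<and> x \<le> v \<and> Inf K = u \<and> Sup K = v"
        if xK: "(x, K) \<in> p" for x K
      proof -
        obtain u v where "K = cbox u v" using pD(4)[OF xK] by auto
        moreover have "x \<in> K" "K \<subseteq> {a..b}" using pD(2,3)[OF xK] by auto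
        ultimately show ?thesis by (intro exI[of _ u] exI[of _ v]) auto
      qed
      define pN where "pN = {t \<in> p. fst t \<in> N}"
      define G where "G = (\<lambda>(x,K). measure lborel K *\<^sub>R h0 x - (f (Sup K) - f (Inf K)))"
      have "(\<Sum>(x, k)\<in>p. measure lborel k *\<^sub>R h0 x) - (f b - f a) = sum G p"
        unfolding ba(2)[symmetric] G_def by (simp add: sum_subtractf[symmetric] case_prod_unfold)
      also have "\<dots> = sum G (p - pN) + sum G pN"
        by (rule sum.subset_diff) (auto simp: pN_def fin)
      finally have "norm ((\<Sum>(x, k)\<in>p. measure lborel k *\<^sub>R h0 x) - (f b - f a)) \<le> norm (sum G (p - pN)) + norm (sum G pN)"
        by (metis norm_triangle_ineq)
      also have "norm (sum G (p - pN)) \<le> (\<Sum>(x,K)\<in>p - pN. e1 * (Sup K - Inf K))"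
      proof (rule sum_norm_le, clarify)
        fix x K assume xK: "(x, K) \<in> p" "(x, K) \<notin> pN"
        obtain u v where uv: "K = {u..v}" "u \<le> v" "a \<le> u" "v \<le> b" "u \<le> x" "x \<le> v" "Inf K = u" "Sup K = v"
          using K[OF xK(1)] by auto
        have xN: "x \<notin> N" "x \<in> {a..b} - N" using xK uv by (auto simp: pN_def)
        have "K \<subseteq> \<gamma> x" using fine xK(1) unfolding fine_def by blast
        then have "K \<subseteq> ball x (d x)" using xN by (simp add: \<gamma>_def)
        moreover have "u \<in> K" "v \<in> K" using uv(1,2) by auto
        ultimately have "u \<in> ball x (d x)" "v \<in> ball x (d x)" by blast+
        then have *: "norm (u - x) < d x" "norm (v - x) < d x"
          by (simp_all add: dist_real_def abs_minus_commute)
        \<comment> \<open>Both estimates start at the tag \<open>x\<close>, the only point where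
          differentiability is known. As \<open>x\<close> lies between \<open>u\<close> and
          \<open>v\<close>, the two errors add up to \<open>e1 * (v - u)\<close>.\<close>
        have "norm (f u - f x - (u-x) *\<^sub>R h x) \<le> e1 * norm (u-x)" "norm (f v - f x - (v-x) *\<^sub>R h x) \<le> e1 * norm (v-x)"
          by (rule d; use * xN uv in auto)+
        moreover have "e1 * norm (u-x) + e1 * norm (v-x) = e1 * (v - u)"
          using uv by (simp add: algebra_simps)
        moreover have "G (x, K) = (f u - f x - (u-x) *\<^sub>R h x) - (f v - f x - (v-x) *\<^sub>R h x)"
          using uv xN by (simp add: G_def h0_def algebra_simps)
        ultimately have "norm (G (x, K)) \<le> e1 * (v - u)"
          by (smt (verit) real_norm_def)
        then show "norm (G (x, K)) \<le> e1 * (Sup K - Inf K)" using uv by simp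
      qed
      also have "\<dots> \<le> (\<Sum>(x,K)\<in>p. e1 * (Sup K - Inf K))"
      proof (rule sum_mono2[OF fin])
        show "0 \<le> (case t of (x, K) \<Rightarrow> e1 * (Sup K - Inf K))" if "t \<in> p - (p - pN)" for t
          using K[of "fst t" "snd t"] that \<open>e1 > 0\<close> by (auto simp: case_prod_unfold)
      qed blast
      also have "\<dots> = e1 * (b - a)" by (simp add: ba(1)[symmetric] sum_distrib_left case_prod_unfold)
      also have "\<dots> \<le> e / 2" using \<open>e > 0\<close> \<open>a \<le> b\<close> by (simp add: e1_def field_simps)
      also have "norm (sum G pN) < e / 2"
      proof -
        \<comment> \<open>Absolute continuity speaks of a set of endpoint pairs, and different tags
          may share one degenerate interval. Such intervals have zero increment; without them the
          passage to endpoint pairs is injective.\<close>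
        define q where "q = {t \<in> pN. Inf (snd t) < Sup (snd t)}"
        define i where "i = (\<lambda>t :: real \<times> real set. (Inf (snd t), Sup (snd t)))"
        define D where "D = i ` q"
        have finq: "finite q" using fin by (simp add: q_def pN_def)
        have qp: "q \<subseteq> p" by (auto simp: q_def pN_def)
        have disj: "{Inf (snd s)<..<Sup (snd s)} \<inter> {Inf (snd t)<..<Sup (snd t)} = {}"
          if st: "s \<in> q" "t \<in> q" "s \<noteq> t" for s t
        proof -
          have sp: "(fst s, snd s) \<in> p" "(fst t, snd t) \<in> p" using st qp by auto
          obtain u v where uv: "snd s = {u..v}" "Inf (snd s) = u" "Sup (snd s) = v"
            using K[OF sp(1)] by metis
          obtain u' v' where uv': "snd t = {u'..v'}" "Inf (snd t) = u'" "Sup (snd t) = v'"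
            using K[OF sp(2)] by metis
          have "interior (snd s) \<inter> interior (snd t) = {}"
            using pD(5)[of "fst s" "snd s" "fst t" "snd t"] qp st by auto
          then show ?thesis using uv uv' by (simp add: interior_atLeastAtMost_real)
        qed
        have inj: "inj_on i q"
        proof (rule inj_onI, rule ccontr)
          fix s t assume st: "s \<in> q" "t \<in> q" "i s = i t" "s \<noteq> t"
          then have "{Inf (snd s)<..<Sup (snd s)} = {}" using disj[OF st(1,2,4)] by (auto simp: i_def)
          then show False using st(1) by (simp add: q_def)
        qed
        have Dp: "\<forall>(x, y)\<in>D. a \<le> x \<and> x \<le> y \<and> y \<le> b"
          using K qp by (fastforce simp: D_def i_def)
        have DU: "{x<..<y} \<subseteq> U" if "(x, y) \<in> D" for x y
        proof -
          from that obtain t where t: "t \<in> q" "x = Inf (snd t)" "y = Sup (snd t)" by (auto simp: D_def i_def)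
          have "t \<in> p" "fst t \<in> N" using t(1) by (auto simp: q_def pN_def)
          then have "snd t \<subseteq> \<gamma> (fst t)" using fine unfolding fine_def by (cases t) auto
          then have "snd t \<subseteq> U" using \<open>fst t \<in> N\<close> by (simp add: \<gamma>_def)
          moreover have "{x<..<y} \<subseteq> snd t" using K[of "fst t" "snd t"] t qp by force
          ultimately show ?thesis by blast
        qed
        have disjD: "disjoint_family_on (\<lambda>(x, y). {x<..<y}) D"
          unfolding disjoint_family_on_def D_def i_def using disj by fastforce
        have finD: "finite D" using finq by (simp add: D_def)
        have sets: "(\<lambda>(x, y). {x<..<y}) ` D \<subseteq> sets lebesgue" by auto
        have "(\<Sum>(x, y)\<in>D. y - x) = (\<Sum>t\<in>D. measure lebesgue ((\<lambda>(x, y). {x<..<y}) t))"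
          by (rule sum.cong) (use Dp in auto)
        also have "\<dots> = measure lebesgue (\<Union>t\<in>D. (\<lambda>(x, y). {x<..<y}) t)"
          by (rule measure_finite_Union[symmetric, OF finD sets disjD]) (use Dp in auto)
        also have "\<dots> \<le> measure lebesgue U"
        proof (rule measure_mono_fmeasurable)
          show "(\<Union>t\<in>D. (\<lambda>(x, y). {x<..<y}) t) \<subseteq> U" using DU by auto
          show "(\<Union>t\<in>D. (\<lambda>(x, y). {x<..<y}) t) \<in> sets lebesgue"
            by (rule sets.finite_UN[OF finD]) auto
          have "emeasure lebesgue U < \<infinity>" by (rule less_trans[OF emU]) simp
          then show "U \<in> lmeasurable" using U(1) by (simp add: fmeasurable_def borel_open)
        qed
        also have "\<dots> < \<delta>"
        proof -
          have "emeasure lebesgue U = ennreal (measure lebesgue U)"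
            using emU by (intro emeasure_eq_ennreal_measure) auto
          then show ?thesis using emU \<open>\<delta> > 0\<close> by (simp add: ennreal_less_iff)
        qed
        finally have "(\<Sum>(x, y)\<in>D. \<bar>f y - f x\<bar>) < e / 2"
          by (rule \<delta>[OF finD Dp disjD])
        moreover have "(\<Sum>(x, y)\<in>D. \<bar>f y - f x\<bar>) = (\<Sum>t\<in>q. \<bar>f (Sup (snd t)) - f (Inf (snd t))\<bar>)"
          unfolding D_def by (subst sum.reindex[OF inj]) (simp add: i_def)
        also have "\<dots> = (\<Sum>t\<in>pN. \<bar>f (Sup (snd t)) - f (Inf (snd t))\<bar>)"
        proof (rule sum.mono_neutral_left)
          show "finite pN" using fin by (simp add: pN_def)
          show "q \<subseteq> pN" by (auto simp: q_def)
          show "\<forall>t\<in>pN - q. \<bar>f (Sup (snd t)) - f (Inf (snd t))\<bar> = 0"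
          proof
            fix t assume t: "t \<in> pN - q"
            then have "t \<in> p" "\<not> Inf (snd t) < Sup (snd t)" by (auto simp: pN_def q_def)
            then have "Inf (snd t) = Sup (snd t)" using K[of "fst t" "snd t"] by force
            then show "\<bar>f (Sup (snd t)) - f (Inf (snd t))\<bar> = 0" by simp
          qed
        qed
        moreover have "norm (sum G pN) \<le> (\<Sum>t\<in>pN. \<bar>f (Sup (snd t)) - f (Inf (snd t))\<bar>)"
          by (rule sum_norm_le) (auto simp: G_def pN_def h0_def)
        ultimately show ?thesis by linarith
      qed
      finally show ?thesis by simp
    qed
    show "\<exists>\<gamma>. gauge \<gamma> \<and>
      (\<forall>\<D>. \<D> tagged_division_of {a..b} \<and> \<gamma> fine \<D> \<longrightarrow>
        norm ((\<Sum>(x, k)\<in>\<D>. measure lborel k *\<^sub>R h0 x) - (f b - f a)) < e)"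
      by (rule exI[of _ \<gamma>], rule conjI[OF g], intro allI impI, elim conjE, rule bound)
  qed
  then show ?thesis
    by (rule has_integral_spike[of N, rotated 2])
      (use N in \<open>auto simp: h0_def negligible_iff_null_sets\<close>)
qed

section \<open>Weak derivatives\<close>

text \<open>For a Borel version \<open>g\<close> of \<open>f\<close>, the positive and the negative
  part of \<open>g\<close> are densities of two finite measures that agree on all half-lines
  \<open>{x<..}\<close>. The measures coincide, hence so do the densities almost everywhere; where
  both parts are equal, \<open>g\<close> vanishes.\<close>

lemma AE_zero_if_tail_integrals_zero:
  fixes f :: "real \<Rightarrow> real"
  assumes f: "integrable lebesgue f" and zero: "\<And>x. (LINT y|lebesgue. indicator {x<..} y * f y) = 0"
  shows "AE x in lebesgue. f x = 0"
proof -
  obtain g where g [measurable]: "g \<in> borel_measurable lborel" and fg: "AE x in lborel. f x = g x"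
    using completion_ex_borel_measurable_real[of f lborel] f by auto
  have fgL: "AE x in lebesgue. f x = g x" using fg by (rule AE_completion)
  have "integrable lebesgue g"
    using f by (rule integrable_cong_AE_imp) (use fgL g in \<open>auto simp: measurable_completion eq_commute\<close>)
  then have gi: "integrable lborel g" using g by (simp add: integrable_completion)
  define P where "P x = ennreal (max 0 (g x))" for x
  define Q where "Q x = ennreal (max 0 (- g x))" for x
  have [measurable]: "P \<in> borel_measurable lborel" "Q \<in> borel_measurable lborel"
    unfolding P_def Q_def by measurable
  have int: "integrable lborel (\<lambda>y. indicator {x<..} y * max 0 (g y))"
            "integrable lborel (\<lambda>y. indicator {x<..} y * max 0 (- g y))" for x
    by (rule Bochner_Integration.integrable_bound[OF gi]; auto simp: indicator_def)+
  have eP: "emeasure (density lborel P) {x<..} = ennreal (LINT y|lborel. indicator {x<..} y * max 0 (g y))" for x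
  proof -
    have "emeasure (density lborel P) {x<..} = (\<integral>\<^sup>+ y. ennreal (indicator {x<..} y * max 0 (g y)) \<partial>lborel)"
      by (subst emeasure_density) (auto simp: P_def indicator_def intro!: nn_integral_cong)
    also have "\<dots> = ennreal (LINT y|lborel. indicator {x<..} y * max 0 (g y))"
      by (rule nn_integral_eq_integral[OF int(1)]) auto
    finally show ?thesis .
  qed
  have eQ: "emeasure (density lborel Q) {x<..} = ennreal (LINT y|lborel. indicator {x<..} y * max 0 (- g y))" for x
  proof -
    have "emeasure (density lborel Q) {x<..} = (\<integral>\<^sup>+ y. ennreal (indicator {x<..} y * max 0 (- g y)) \<partial>lborel)"
      by (subst emeasure_density) (auto simp: Q_def indicator_def intro!: nn_integral_cong)
    also have "\<dots> = ennreal (LINT y|lborel. indicator {x<..} y * max 0 (- g y))"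
      by (rule nn_integral_eq_integral[OF int(2)]) auto
    finally show ?thesis .
  qed
  have "(LINT y|lborel. indicator {x<..} y * max 0 (g y)) = (LINT y|lborel. indicator {x<..} y * max 0 (- g y))" for x
  proof -
    have "(LINT y|lborel. indicator {x<..} y * max 0 (g y)) - (LINT y|lborel. indicator {x<..} y * max 0 (- g y))
       = (LINT y|lborel. indicator {x<..} y * g y)"
      unfolding Bochner_Integration.integral_diff[OF int, symmetric]
      by (rule Bochner_Integration.integral_cong) (auto simp: indicator_def)
    also have "\<dots> = (LINT y|lebesgue. indicator {x<..} y * g y)"
      by (rule integral_completion[symmetric]) measurable
    also have "\<dots> = (LINT y|lebesgue. indicator {x<..} y * f y)"
    proof (rule integral_cong_AE)
      show "(\<lambda>y. indicator {x<..} y * g y) \<in> borel_measurable lebesgue"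
        by (rule measurable_completion) measurable
      show "(\<lambda>y. indicator {x<..} y * f y) \<in> borel_measurable lebesgue"
        using f by (intro borel_measurable_times borel_measurable_indicator) auto
      show "AE y in lebesgue. indicator {x<..} y * g y = indicator {x<..} y * f y"
        using fgL by eventually_elim simp
    qed
    finally show ?thesis using zero[of x] by simp
  qed
  then have "density lborel P = density lborel Q"
    by (intro measure_eqI_lessThan) (simp_all add: eP eQ)
  then have "AE x in lborel. P x = Q x"
    by (subst (asm) sigma_finite_measure.density_unique_iff[OF sigma_finite_lborel]) auto
  then have "AE x in lborel. g x = 0"
    by eventually_elim (auto simp: P_def Q_def max_def split: if_splits)
  with fg have "AE x in lborel. f x = 0" by eventually_elim simp
  then show ?thesis by (rule AE_completion)
qed

text \<open>Extending \<open>g - h\<close> by zero turns the tail integral beyond x into the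
  integral over [max a x, b], up to a single point. This is what identifies two weak derivatives of
  one function.\<close>

lemma AE_eq_if_interval_integrals_eq:
  fixes g h :: "real \<Rightarrow> real"
  assumes g: "integrable (lebesgue_on {a..b}) g" and h: "integrable (lebesgue_on {a..b}) h"
    and eq: "\<And>s. a \<le> s \<Longrightarrow> s \<le> b \<Longrightarrow> (LINT x|lebesgue_on {s..b}. g x) = (LINT x|lebesgue_on {s..b}. h x)"
  shows "AE x in lebesgue_on {a..b}. g x = h x"
proof -
  define f where "f x = (if x \<in> {a..b} then g x - h x else 0)" for x
  have gh: "integrable (lebesgue_on {a..b}) (\<lambda>x. g x - h x)" using g h by auto
  have fi: "integrable lebesgue f"
    unfolding f_def using gh by (subst Lebesgue_Measure.integrable_restrict_UNIV) auto
  have "(LINT y|lebesgue. indicator {x<..} y * f y) = 0" for x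
  proof -
    define s where "s = max a x"
    have "(LINT y|lebesgue. indicator {x<..} y * f y) = (LINT y|lebesgue. (if y \<in> {s..b} then g y - h y else 0))"
    proof (rule integral_cong_AE)
      show "(\<lambda>y. indicator {x<..} y * f y) \<in> borel_measurable lebesgue"
        using fi by (intro borel_measurable_times borel_measurable_indicator) auto
      have "(\<lambda>y. indicator {s..b} y * f y) \<in> borel_measurable lebesgue"
        using fi by (intro borel_measurable_times borel_measurable_indicator) auto
      also have "(\<lambda>y. indicator {s..b} y * f y) = (\<lambda>y. (if y \<in> {s..b} then g y - h y else 0))"
        by (auto simp: f_def s_def indicator_def fun_eq_iff)
      finally show "(\<lambda>y. (if y \<in> {s..b} then g y - h y else 0)) \<in> borel_measurable lebesgue" .
      have "AE y in lebesgue. y \<notin> {x}" by (rule AE_not_in) auto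
      then show "AE y in lebesgue. indicator {x<..} y * f y = (if y \<in> {s..b} then g y - h y else 0)"
        by eventually_elim (auto simp: f_def s_def indicator_def)
    qed
    also have "\<dots> = (LINT y|lebesgue_on {s..b}. g y - h y)"
      by (rule Lebesgue_Measure.integral_restrict_UNIV) auto
    also have "\<dots> = 0"
    proof (cases "s \<le> b")
      case True
      have sub: "integrable (lebesgue_on {s..b}) g" "integrable (lebesgue_on {s..b}) h"
        by (rule integrable_subinterval[OF g], simp add: s_def) (rule integrable_subinterval[OF h], simp add: s_def)
      show ?thesis
        unfolding Bochner_Integration.integral_diff[OF sub] using eq[of s] True by (simp add: s_def)
    qed simp
    finally show ?thesis .
  qed
  with fi have "AE x in lebesgue. f x = 0" by (rule AE_zero_if_tail_integrals_zero)
  then have "AE x in lebesgue. x \<in> {a..b} \<longrightarrow> g x = h x"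
    by eventually_elim (auto simp: f_def split: if_splits)
  then show ?thesis by (subst AE_restrict_space_iff) auto
qed

section \<open>Smooth steps, mollification and the increments of a weakly differentiable
  function\<close>

lemma DERIV_max_0_power2: "((\<lambda>y::real. (max 0 y)\<^sup>2) has_real_derivative 2 * max 0 x) (at x)"
proof -
  consider "x < 0" | "x > 0" | "x = 0" by linarith
  then show ?thesis
  proof cases
    case 1
    have "((\<lambda>y::real. (max 0 y)\<^sup>2) has_real_derivative 0) (at x)"
      by (rule has_field_derivative_transform_within_open[of "\<lambda>_. 0" _ _ "{..<0}"])
        (use 1 in \<open>auto simp: max_def\<close>)
    then show ?thesis using 1 by (simp add: max_def)
  next
    case 2
    have "((\<lambda>y::real. (max 0 y)\<^sup>2) has_real_derivative 2 * x) (at x)"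
      by (rule has_field_derivative_transform_within_open[of "\<lambda>y. y\<^sup>2" _ _ "{0<..}"])
        (use 2 in \<open>auto simp: max_def intro!: derivative_eq_intros\<close>)
    then show ?thesis using 2 by (simp add: max_def)
  next
    case 3
    have "((\<lambda>h::real. max 0 h) \<longlongrightarrow> max 0 0) (at 0)"
      by (intro tendsto_intros)
    then have "((\<lambda>h::real. max 0 h) \<longlongrightarrow> 0) (at 0)" by simp
    then have "((\<lambda>h::real. (max 0 (0 + h))\<^sup>2 / h) \<longlongrightarrow> 0) (at 0)"
      by (rule Lim_transform_eventually)
        (auto simp: eventually_at_filter power2_eq_square max_def divide_simps)
    then show ?thesis using 3 by (simp add: DERIV_def)
  qed
qed

text \<open>A quadratic spline is enough, since test functions are only required to be C1. The
  coefficients 2, -4, 2 at the knots 0, 1/2, 1 make \<sigma>' the tent function of height 2 on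
  [0,1], which has integral 1.\<close>

lemma smooth_step_exists:
  obtains \<sigma> \<sigma>' :: "real \<Rightarrow> real" where
    "\<And>x. (\<sigma> has_real_derivative \<sigma>' x) (at x)" "continuous_on UNIV \<sigma>'"
    "\<And>x. 0 \<le> \<sigma>' x" "\<And>x. x \<notin> {0..1} \<Longrightarrow> \<sigma>' x = 0"
    "\<And>x. x \<le> 0 \<Longrightarrow> \<sigma> x = 0" "\<And>x. 1 \<le> x \<Longrightarrow> \<sigma> x = 1"
    "\<And>x. 0 \<le> \<sigma> x \<and> \<sigma> x \<le> 1"
proof -
  define \<sigma> \<sigma>' :: "real \<Rightarrow> real"
    where "\<sigma> y = 2 * (max 0 y)\<^sup>2 - 4 * (max 0 (y - 1/2))\<^sup>2 + 2 * (max 0 (y - 1))\<^sup>2"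
      and "\<sigma>' y = 2 * (2 * max 0 y) - 4 * (2 * max 0 (y - 1/2)) + 2 * (2 * max 0 (y - 1))" for y
  have shift: "((\<lambda>y. (max 0 (y - c))\<^sup>2) has_real_derivative 2 * max 0 (x - c)) (at x)" for c x :: real
    using DERIV_shift[of "\<lambda>y. (max 0 y)\<^sup>2" _ x "-c"] DERIV_max_0_power2[of "x - c"] by simp
  have D: "(\<sigma> has_real_derivative \<sigma>' x) (at x)" for x
    unfolding \<sigma>_def \<sigma>'_def
    by (intro DERIV_add DERIV_diff DERIV_cmult DERIV_max_0_power2 shift)
  have cont: "continuous_on UNIV \<sigma>'" unfolding \<sigma>'_def by (intro continuous_intros)
  have nonneg: "0 \<le> \<sigma>' x" for x by (auto simp: \<sigma>'_def max_def)
  have s0: "\<sigma> x = 0" if "x \<le> 0" for x using that by (auto simp: \<sigma>_def max_def)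
  have s1: "\<sigma> x = 1" if "1 \<le> x" for x using that by (auto simp: \<sigma>_def max_def power2_eq_square algebra_simps)
  have mono: "\<sigma> x \<le> \<sigma> y" if "x \<le> y" for x y
    by (rule DERIV_nonneg_imp_nondecreasing[OF that]) (use D nonneg in blast)
  have "0 \<le> \<sigma> x \<and> \<sigma> x \<le> 1" for x
    using mono[of "min x 0" x] mono[of x "max x 1"] s0[of "min x 0"] s1[of "max x 1"] by auto
  moreover have "\<sigma>' x = 0" if "x \<notin> {0..1}" for x using that by (auto simp: \<sigma>'_def max_def)
  ultimately show ?thesis using that[OF D cont nonneg _ s0 s1] by blast
qed

text \<open>The kernel is one-sided: it lives on [s, s + e n] and has mass 1 in [0,T] as soon as e n
  < T - s. Hence s = 0 is allowed and s = T is not. On its support v differs from v s by less than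
  r/2.\<close>

lemma mollifier_tendsto:
  fixes v \<sigma> \<sigma>' :: "real \<Rightarrow> real"
  assumes \<sigma>: "\<And>x. (\<sigma> has_real_derivative \<sigma>' x) (at x)" "continuous_on UNIV \<sigma>'"
    "\<And>x. 0 \<le> \<sigma>' x" "\<And>x. x \<notin> {0..1} \<Longrightarrow> \<sigma>' x = 0"
    "\<And>x. x \<le> 0 \<Longrightarrow> \<sigma> x = 0" "\<And>x. 1 \<le> x \<Longrightarrow> \<sigma> x = 1"
    and v: "continuous_on {0..T} v" and s: "0 \<le> s" "s < T" and e: "\<And>n. 0 < e n" "e \<longlonglongrightarrow> 0"
  shows "(\<lambda>n. LINT x|lebesgue_on {0..T}. v x * (\<sigma>' ((x - s) / e n) / e n)) \<longlonglongrightarrow> v s"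
proof (rule LIMSEQ_I)
  fix r :: real assume "r > 0"
  obtain d where "d > 0" and d: "\<And>x. x \<in> {0..T} \<Longrightarrow> dist x s < d \<Longrightarrow> dist (v x) (v s) < r / 2"
    using v s \<open>r > 0\<close> unfolding continuous_on_iff by (metis atLeastAtMost_iff half_gt_zero less_imp_le)
  have "eventually (\<lambda>n. e n < min d (T - s)) sequentially"
    by (rule order_tendstoD(2)[OF e(2)]) (use \<open>d > 0\<close> s in auto)
  then obtain N where N: "\<And>n. n \<ge> N \<Longrightarrow> e n < d \<and> e n < T - s"
    by (auto simp: eventually_sequentially)
  have "norm ((LINT x|lebesgue_on {0..T}. v x * (\<sigma>' ((x - s) / e n) / e n)) - v s) < r" if n: "n \<ge> N" for n
  proof -
    define k where "k x = \<sigma>' ((x - s) / e n) / e n" for x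
    have en: "e n > 0" using e by auto
    have kcont: "continuous_on A k" for A
      unfolding k_def by (intro continuous_intros continuous_on_compose2[OF \<sigma>(2)]) (use en in auto)
    have k0: "k x \<ge> 0" for x using \<sigma>(3) en by (simp add: k_def)
    have vcont: "continuous_on {0..T} (\<lambda>x. v x * k x)" "continuous_on {0..T} (\<lambda>x. (v x - v s) * k x)"
      by (intro continuous_intros v kcont)+
    have "(LINT x|lebesgue_on {0..T}. k x) = \<sigma> ((T - s) / e n) - \<sigma> ((0 - s) / e n)"
    proof (rule lebesgue_integral_FTC)
      fix x assume "x \<in> {0..T}"
      have "((\<lambda>x. \<sigma> ((x - s) / e n)) has_real_derivative \<sigma>' ((x - s) / e n) * (1 / e n)) (at x)"
        by (rule DERIV_chain2[OF \<sigma>(1)]) (use en in \<open>auto intro!: derivative_eq_intros\<close>)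
      then show "((\<lambda>x. \<sigma> ((x - s) / e n)) has_real_derivative k x) (at x within {0..T})"
        by (auto simp: k_def intro: has_field_derivative_at_within)
    qed (use s kcont in auto)
    also have "\<dots> = 1"
      using \<sigma>(5)[of "(0 - s) / e n"] \<sigma>(6)[of "(T - s) / e n"] N[OF n] en s
      by (auto simp: divide_simps)
    finally have k1: "(LINT x|lebesgue_on {0..T}. k x) = 1" .
    have "(LINT x|lebesgue_on {0..T}. v x * k x) - v s = (LINT x|lebesgue_on {0..T}. v x * k x - v s * k x)"
      using k1 continuous_imp_integrable_real[OF kcont] continuous_imp_integrable_real[OF vcont(1)] by simp
    also have "\<dots> = (LINT x|lebesgue_on {0..T}. (v x - v s) * k x)" by (simp add: algebra_simps)
    finally have "norm ((LINT x|lebesgue_on {0..T}. v x * k x) - v s) = norm (LINT x|lebesgue_on {0..T}. (v x - v s) * k x)"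
      by simp
    also have "\<dots> \<le> (LINT x|lebesgue_on {0..T}. norm ((v x - v s) * k x))"
      by (rule integral_norm_bound)
    also have "\<dots> \<le> (LINT x|lebesgue_on {0..T}. r / 2 * k x)"
    proof (rule integral_mono)
      show "integrable (lebesgue_on {0..T}) (\<lambda>x. norm ((v x - v s) * k x))"
        using continuous_imp_integrable_real[OF vcont(2)] by (rule integrable_norm)
      show "integrable (lebesgue_on {0..T}) (\<lambda>x. r / 2 * k x)"
        using continuous_imp_integrable_real[OF kcont] by simp
      fix x assume "x \<in> space (lebesgue_on {0..T})"
      then have x: "x \<in> {0..T}" by simp
      show "norm ((v x - v s) * k x) \<le> r / 2 * k x"
      proof (cases "(x - s) / e n \<in> {0..1}")
        case True
        then have "dist x s < d" using en N[OF n] by (auto simp: dist_real_def divide_simps)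
        then have "\<bar>v x - v s\<bar> \<le> r / 2" using d[OF x] by (simp add: dist_real_def)
        from mult_right_mono[OF this k0[of x]] show ?thesis using k0[of x] by (simp add: abs_mult)
      qed (simp add: k_def \<sigma>(4))
    qed
    also have "\<dots> = r / 2" using k1 by simp
    finally show ?thesis using \<open>r > 0\<close> by (simp add: k_def)
  qed
  then show "\<exists>no. \<forall>n\<ge>no. norm ((LINT x|lebesgue_on {0..T}. v x * (\<sigma>' ((x - s) / e n) / e n)) - v s) < r"
    by blast
qed

text \<open>Testing against smoothed indicator functions of \<open>(a,b]\<close>.\<close>

lemma weak_derivative_integral:
  assumes T: "0 < T" and v: "continuous_on {0..T} v" and g: "integrable (lebesgue_on {0..T}) g"
    and w: "has_weak_derivative T v g" and st: "0 \<le> s" "s \<le> t" "t \<le> T"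
  shows "(LINT x|lebesgue_on {s..t}. g x) = v t - v s"
proof -
  obtain \<sigma> \<sigma>' :: "real \<Rightarrow> real" where \<sigma>:
    "\<And>x. (\<sigma> has_real_derivative \<sigma>' x) (at x)" "continuous_on UNIV \<sigma>'"
    "\<And>x. 0 \<le> \<sigma>' x" "\<And>x. x \<notin> {0..1} \<Longrightarrow> \<sigma>' x = 0"
    "\<And>x. x \<le> 0 \<Longrightarrow> \<sigma> x = 0" "\<And>x. 1 \<le> x \<Longrightarrow> \<sigma> x = 1"
    "\<And>x. 0 \<le> \<sigma> x \<and> \<sigma> x \<le> 1"
    by (rule smooth_step_exists) blast
  have \<sigma>cont: "continuous_on A \<sigma>" for A
    using \<sigma>(1) by (meson DERIV_isCont continuous_at_imp_continuous_on)
  have int: "integrable (lebesgue_on {a..b}) g" if "0 \<le> a" "b \<le> T" for a b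
    using g by (rule integrable_subinterval) (use that in auto)
  define G where "G x = (LINT y|lebesgue_on {0..x}. g y)" for x
  have Gdiff: "(LINT x|lebesgue_on {a..b}. g x) = G b - G a" if "0 \<le> a" "a \<le> b" "b \<le> T" for a b
    unfolding G_def using integral_combine[OF int[of 0 b], of a] that by simp
  have interior: "G b - G a = v b - v a" if ab: "0 < a" "a < b" "b < T" for a b
  proof -
    \<comment> \<open>The denominator keeps b + e n strictly below T, so that the support
      [a, b + e n] of the test function is compact in the open interval for every n.\<close>
    define e where "e n = (T - b) / (real n + 2)" for n
    have e: "e n > 0" "b + e n < T" for n
    proof -
      show "e n > 0" using ab by (simp add: e_def)
      have "(T - b) * 1 < (T - b) * (real n + 2)" using ab by (intro mult_strict_left_mono) auto
      then have "e n < T - b" by (simp add: e_def pos_divide_less_eq)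
      then show "b + e n < T" by simp
    qed
    have elim: "e \<longlonglongrightarrow> 0" unfolding e_def by real_asymp
    \<comment> \<open>A plateau that climbs to 1 on [a, a + e n] and descends on [b, b + e n]. Its
      derivative is a difference of two mollifiers, so testing with it gives v a - v b on one side
      and minus the integral of g over (a,b] on the other.\<close>
    define \<phi> where "\<phi> n x = \<sigma> ((x - a) / e n) - \<sigma> ((x - b) / e n)" for n x
    define k where "k c n x = \<sigma>' ((x - c) / e n) / e n" for c n x
    have kcont: "continuous_on A (k c n)" for A c n
      unfolding k_def by (intro continuous_intros continuous_on_compose2[OF \<sigma>(2)]) (use e(1)[of n] in auto)
    have \<phi>D: "(\<phi> n has_real_derivative k a n x - k b n x) (at x)" for n x
    proof -
      have "((\<lambda>x. \<sigma> ((x - c) / e n)) has_real_derivative \<sigma>' ((x - c) / e n) * (1 / e n)) (at x)" for c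
        by (rule DERIV_chain2[OF \<sigma>(1)]) (use e(1)[of n] in \<open>auto intro!: derivative_eq_intros\<close>)
      from DERIV_diff[OF this[of a] this[of b]] show ?thesis
        unfolding \<phi>_def k_def by simp
    qed
    have test: "test_function T (\<phi> n)" for n
      unfolding test_function_def
    proof
      show "\<phi> n C1_differentiable_on UNIV"
        unfolding C1_differentiable_on_def
        by (rule exI[of _ "\<lambda>x. k a n x - k b n x"])
          (use \<phi>D continuous_on_diff[OF kcont kcont] in \<open>simp add: has_real_derivative_iff_has_vector_derivative[symmetric]\<close>)
      have "\<phi> n x = 0" if x: "x \<notin> {a..b + e n}" for x
      proof (cases "x < a")
        case True
        then show ?thesis using ab e(1)[of n] by (simp add: \<phi>_def \<sigma>(5) divide_nonpos_pos)
      next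
        case False
        then have "x > b + e n" using x by simp
        then have "1 \<le> (x - a) / e n" "1 \<le> (x - b) / e n" using e(1)[of n] ab by (auto simp: field_simps)
        then show ?thesis by (simp add: \<phi>_def \<sigma>(6))
      qed
      then show "\<exists>K. compact K \<and> K \<subseteq> {0<..<T} \<and> (\<forall>t. t \<notin> K \<longrightarrow> \<phi> n t = 0)"
        using ab e(2)[of n] by (intro exI[of _ "{a..b + e n}"]) auto
    qed
    have "(\<lambda>n. (LINT x|lebesgue_on {0..T}. v x * k a n x) - (LINT x|lebesgue_on {0..T}. v x * k b n x)) \<longlonglongrightarrow> v a - v b"
      unfolding k_def
      by (rule tendsto_diff; rule mollifier_tendsto[OF \<sigma>(1-6) v _ _ e(1) elim]) (use ab in auto)
    also have "(\<lambda>n. (LINT x|lebesgue_on {0..T}. v x * k a n x) - (LINT x|lebesgue_on {0..T}. v x * k b n x))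
        = (\<lambda>n. - (LINT x|lebesgue_on {0..T}. g x * \<phi> n x))"
    proof
      fix n
      have ii: "integrable (lebesgue_on {0..T}) (\<lambda>x. v x * k c n x)" for c
        by (intro continuous_imp_integrable_real continuous_intros v kcont)
      have "(LINT x|lebesgue_on {0..T}. v x * k a n x) - (LINT x|lebesgue_on {0..T}. v x * k b n x)
          = (LINT x|lebesgue_on {0..T}. v x * deriv (\<phi> n) x)"
        by (subst Bochner_Integration.integral_diff[symmetric, OF ii ii])
          (simp add: DERIV_imp_deriv[OF \<phi>D] algebra_simps)
      also have "\<dots> = - (LINT x|lebesgue_on {0..T}. g x * \<phi> n x)"
        using w test[of n] by (simp add: has_weak_derivative_def)
      finally show "(LINT x|lebesgue_on {0..T}. v x * k a n x) - (LINT x|lebesgue_on {0..T}. v x * k b n x)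
          = - (LINT x|lebesgue_on {0..T}. g x * \<phi> n x)" .
    qed
    finally have lim1: "(\<lambda>n. - (LINT x|lebesgue_on {0..T}. g x * \<phi> n x)) \<longlonglongrightarrow> v a - v b" .
    have gm: "g \<in> borel_measurable (lebesgue_on {0..T})" using g by auto
    have "(\<lambda>n. LINT x|lebesgue_on {0..T}. g x * \<phi> n x) \<longlonglongrightarrow> (LINT x|lebesgue_on {0..T}. g x * indicator {a<..b} x)"
    proof (rule integral_dominated_convergence[where w = "\<lambda>x. norm (g x)"])
      show "(\<lambda>x. g x * indicator {a<..b} x) \<in> borel_measurable (lebesgue_on {0..T})"
        by (intro borel_measurable_times gm borel_measurable_indicator) (use ab in \<open>auto simp: sets_restrict_space_iff\<close>)
      show "(\<lambda>x. g x * \<phi> n x) \<in> borel_measurable (lebesgue_on {0..T})" for n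
      proof (rule borel_measurable_times[OF gm])
        have "continuous_on {0..T} (\<phi> n)"
          using \<phi>D by (meson DERIV_isCont continuous_at_imp_continuous_on)
        then show "\<phi> n \<in> borel_measurable (lebesgue_on {0..T})"
          by (rule continuous_imp_measurable_on_sets_lebesgue) auto
      qed
      show "integrable (lebesgue_on {0..T}) (\<lambda>x. norm (g x))" using g by (rule integrable_norm)
      have "\<bar>\<phi> n x\<bar> \<le> 1" for n x
        using \<sigma>(7)[of "(x - a) / e n"] \<sigma>(7)[of "(x - b) / e n"] by (auto simp: \<phi>_def abs_le_iff)
      then show "AE x in lebesgue_on {0..T}. norm (g x * \<phi> n x) \<le> norm (g x)" for n
        by (auto simp: abs_mult mult_left_le)
      \<comment> \<open>At x = c the step is always 0, because \<sigma> vanishes at 0. This is why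
        the limits are indicators of half-lines open on the left.\<close>
      have step: "(\<lambda>n. \<sigma> ((x - c) / e n)) \<longlonglongrightarrow> indicator {c<..} x" for x c
      proof (cases "x \<le> c")
        case True
        then show ?thesis using e(1) by (simp add: \<sigma>(5) divide_nonpos_pos)
      next
        case False
        then have "eventually (\<lambda>n. e n < x - c) sequentially"
          by (intro order_tendstoD(2)[OF elim]) auto
        then have "eventually (\<lambda>n. \<sigma> ((x - c) / e n) = 1) sequentially"
        proof eventually_elim
          case (elim n)
          then have "1 \<le> (x - c) / e n" using e(1)[of n] by (simp add: pos_le_divide_eq)
          then show ?case by (rule \<sigma>(6))
        qed
        then show ?thesis using False by (simp add: tendsto_eventually)
      qed
      have "(\<lambda>n. \<phi> n x) \<longlonglongrightarrow> indicator {a<..b} x" for x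
      proof -
        have "indicator {a<..} x - indicator {b<..} x = (indicator {a<..b} x :: real)"
          using ab by (auto simp: indicator_def)
        then show ?thesis
          using tendsto_diff[OF step[of x a] step[of x b]] by (simp add: \<phi>_def)
      qed
      then show "AE x in lebesgue_on {0..T}. (\<lambda>n. g x * \<phi> n x) \<longlonglongrightarrow> g x * indicator {a<..b} x"
        by (auto intro!: tendsto_mult)
    qed
    from LIMSEQ_unique[OF tendsto_minus[OF this] lim1]
    have "(LINT x|lebesgue_on {0..T}. g x * indicator {a<..b} x) = v b - v a" by simp
    also have "(LINT x|lebesgue_on {0..T}. g x * indicator {a<..b} x)
        = (LINT x|lebesgue_on {0..T}. (if x \<in> {a<..b} then g x else 0))"
      by (rule Bochner_Integration.integral_cong) auto
    also have "\<dots> = (LINT x|lebesgue_on {0..T}. (if x \<in> {a..b} then g x else 0))"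
    proof (rule integral_cong_AE)
      show "(\<lambda>x. if x \<in> {a<..b} then g x else 0) \<in> borel_measurable (lebesgue_on {0..T})"
        "(\<lambda>x. if x \<in> {a..b} then g x else 0) \<in> borel_measurable (lebesgue_on {0..T})"
        by (rule measurable_If_set[OF gm]; use ab in \<open>auto simp: sets_restrict_space_iff\<close>)+
      have "AE x in lebesgue_on {0..T}. x \<notin> {a}"
        by (rule AE_not_in) (use ab in auto)
      then show "AE x in lebesgue_on {0..T}. (if x \<in> {a<..b} then g x else 0) = (if x \<in> {a..b} then g x else 0)"
        by eventually_elim auto
    qed
    also have "\<dots> = (LINT x|lebesgue_on {a..b}. g x)"
      by (rule integral_restrict) (use ab in auto)
    finally show ?thesis using Gdiff[of a b] ab by simp
  qed
  have Gcont: "continuous_on {0..T} G"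
    unfolding G_def by (rule indefinite_integral_continuous_real[OF g])
  \<comment> \<open>Test functions vanish near 0 and T, so the identity is known only for interior
    points. Continuity of \<open>G - v\<close> carries it to the endpoints, where the antiperiodic
    condition is imposed.\<close>
  have const: "G x - v x = G (T/2) - v (T/2)" if "x \<in> {0..T}" for x
  proof (rule continuous_constant_on_closure[where S = "{0<..<T}" and f = "\<lambda>x. G x - v x"])
    show "continuous_on (closure {0<..<T}) (\<lambda>x. G x - v x)"
      using T by (simp add: Gcont v continuous_on_diff)
    show "x \<in> closure {0<..<T}" using T that by simp
    fix y assume "y \<in> {0<..<T}"
    then show "G y - v y = G (T/2) - v (T/2)"
      using interior[of y "T/2"] interior[of "T/2" y] T by (cases "y < T/2"; cases "y = T/2") auto
  qed
  show ?thesis using Gdiff[OF st] const[of s] const[of t] st by auto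
qed

lemma has_weak_derivative_C1:
  assumes T: "0 < T" and u: "\<And>t. t \<in> {0..T} \<Longrightarrow> (u has_real_derivative u' t) (at t within {0..T})"
    and u': "continuous_on {0..T} u'"
  shows "has_weak_derivative T u u'"
  unfolding has_weak_derivative_def
proof (intro allI impI)
  fix \<phi> assume "test_function T \<phi>"
  then obtain D K where D: "\<And>x. (\<phi> has_vector_derivative D x) (at x)" "continuous_on UNIV D"
    and K: "K \<subseteq> {0<..<T}" "\<And>t. t \<notin> K \<Longrightarrow> \<phi> t = 0"
    unfolding test_function_def C1_differentiable_on_def by auto
  have D1: "(\<phi> has_real_derivative D x) (at x)" for x
    using D(1) by (simp add: has_real_derivative_iff_has_vector_derivative)
  have D': "deriv \<phi> x = D x" for x using D1 by (rule DERIV_imp_deriv)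
  have cont: "continuous_on {0..T} u" "continuous_on {0..T} \<phi>" "continuous_on {0..T} D"
    using DERIV_continuous_on[OF u] DERIV_continuous_on[OF has_field_derivative_at_within[OF D1]]
      continuous_on_subset[OF D(2)] by auto
  have int: "integrable (lebesgue_on {0..T}) (\<lambda>x. u x * D x)" "integrable (lebesgue_on {0..T}) (\<lambda>x. u' x * \<phi> x)"
    by (intro continuous_imp_integrable_real continuous_intros cont u')+
  have "(LINT x|lebesgue_on {0..T}. u x * D x + u' x * \<phi> x) = u T * \<phi> T - u 0 * \<phi> 0"
  proof (rule lebesgue_integral_FTC)
    fix x assume x: "x \<in> {0..T}"
    show "((\<lambda>x. u x * \<phi> x) has_real_derivative u x * D x + u' x * \<phi> x) (at x within {0..T})"
      using DERIV_mult'[OF u[OF x] has_field_derivative_at_within[OF D1]] .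
  qed (use T in \<open>auto intro!: continuous_intros cont u'\<close>)
  also have "\<dots> = 0"
  proof -
    have "0 \<notin> K" "T \<notin> K" using K(1) by auto
    then show ?thesis by (simp add: K(2))
  qed
  finally show "(LINT t|lebesgue_on {0..T}. u t * deriv \<phi> t) = - (LINT t|lebesgue_on {0..T}. u' t * \<phi> t)"
    unfolding D' using int by simp
qed

section \<open>Integral inequalities\<close>

lemma Holder_integral:
  fixes f g :: "'a \<Rightarrow> real" and p q :: real
  assumes pq: "1 < p" "1 < q" "1 / p + 1 / q = 1"
    and f: "f \<in> borel_measurable M" "integrable M (\<lambda>x. \<bar>f x\<bar> powr p)"
    and g: "g \<in> borel_measurable M" "integrable M (\<lambda>x. \<bar>g x\<bar> powr q)"
  shows "integrable M (\<lambda>x. f x * g x)"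
    and "(LINT x|M. \<bar>f x * g x\<bar>) \<le> (LINT x|M. \<bar>f x\<bar> powr p) powr (1/p) * (LINT x|M. \<bar>g x\<bar> powr q) powr (1/q)"
proof -
  have young: "\<bar>f x * g x\<bar> \<le> \<bar>f x\<bar> powr p / p + \<bar>g x\<bar> powr q / q" for x
    using Youngs_inequality[OF pq, of "\<bar>f x\<bar>" "\<bar>g x\<bar>"] by (simp add: abs_mult)
  show int: "integrable M (\<lambda>x. f x * g x)"
  proof (rule Bochner_Integration.integrable_bound)
    show "integrable M (\<lambda>x. \<bar>f x\<bar> powr p / p + \<bar>g x\<bar> powr q / q)" using f g by simp
    show "AE x in M. norm (f x * g x) \<le> norm (\<bar>f x\<bar> powr p / p + \<bar>g x\<bar> powr q / q)"
      using young by (auto intro!: AE_I2 order_trans[OF young])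
  qed (use f g in measurable)
  define A B where "A = (LINT x|M. \<bar>f x\<bar> powr p)" and "B = (LINT x|M. \<bar>g x\<bar> powr q)"
  have "A \<ge> 0" "B \<ge> 0" by (auto simp: A_def B_def)
  \<comment> \<open>The scaling below divides by both norms. If one of them is zero, the
    corresponding factor is zero almost everywhere and there is nothing left to estimate.\<close>
  have zero: "(LINT x|M. \<bar>f x * g x\<bar>) = 0" if "A = 0 \<or> B = 0"
  proof -
    have "(AE x in M. f x = 0) \<or> (AE x in M. g x = 0)"
      using that integral_nonneg_eq_0_iff_AE[OF f(2)] integral_nonneg_eq_0_iff_AE[OF g(2)]
      by (auto simp: A_def B_def)
    then have "AE x in M. \<bar>f x * g x\<bar> = 0" by auto
    then show ?thesis by (rule integral_eq_zero_AE)
  qed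
  show "(LINT x|M. \<bar>f x * g x\<bar>) \<le> (LINT x|M. \<bar>f x\<bar> powr p) powr (1/p) * (LINT x|M. \<bar>g x\<bar> powr q) powr (1/q)"
  proof (cases "A = 0 \<or> B = 0")
    case True
    then show ?thesis using zero by simp
  next
    case False
    then have AB: "A > 0" "B > 0" using \<open>A \<ge> 0\<close> \<open>B \<ge> 0\<close> by auto
    define a b where "a = A powr (1/p)" and "b = B powr (1/q)"
    have ab: "a > 0" "b > 0" using AB by (auto simp: a_def b_def)
    have abp: "a powr p = A" "b powr q = B" using AB pq by (auto simp: a_def b_def powr_powr)
    have y: "\<bar>f x * g x\<bar> \<le> a * b * (\<bar>f x\<bar> powr p / (p * A) + \<bar>g x\<bar> powr q / (q * B))" for x
    proof -
      have "(\<bar>f x\<bar> / a) * (\<bar>g x\<bar> / b) \<le> (\<bar>f x\<bar> / a) powr p / p + (\<bar>g x\<bar> / b) powr q / q"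
        by (rule Youngs_inequality[OF pq]) (use ab in auto)
      also have "\<dots> = \<bar>f x\<bar> powr p / (p * A) + \<bar>g x\<bar> powr q / (q * B)"
        using ab abp by (simp add: powr_divide mult.commute)
      finally have "a * b * ((\<bar>f x\<bar> / a) * (\<bar>g x\<bar> / b)) \<le> a * b * (\<bar>f x\<bar> powr p / (p * A) + \<bar>g x\<bar> powr q / (q * B))"
        by (rule mult_left_mono) (use ab in auto)
      then show ?thesis using ab by (simp add: abs_mult)
    qed
    have "(LINT x|M. \<bar>f x * g x\<bar>) \<le> (LINT x|M. a * b * (\<bar>f x\<bar> powr p / (p * A) + \<bar>g x\<bar> powr q / (q * B)))"
      by (rule integral_mono) (use y int f g in auto)
    also have "\<dots> = a * b * (A / (p * A) + B / (q * B))"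
      using f g by (simp add: A_def B_def)
    also have "\<dots> = a * b" using AB pq by simp
    finally show ?thesis by (simp add: a_def b_def A_def B_def)
  qed
qed

lemma Cauchy_Schwarz_integral:
  fixes f g :: "'a \<Rightarrow> real"
  assumes f: "f \<in> borel_measurable M" "integrable M (\<lambda>x. (f x)\<^sup>2)"
    and g: "g \<in> borel_measurable M" "integrable M (\<lambda>x. (g x)\<^sup>2)"
  shows "integrable M (\<lambda>x. f x * g x)"
    and "(LINT x|M. \<bar>f x * g x\<bar>)\<^sup>2 \<le> (LINT x|M. (f x)\<^sup>2) * (LINT x|M. (g x)\<^sup>2)"
proof -
  note H = Holder_integral[of 2 2, OF _ _ _ f(1) _ g(1)]
  show "integrable M (\<lambda>x. f x * g x)" by (rule H) (use f g in auto)
  have "(LINT x|M. \<bar>f x * g x\<bar>) \<le> (LINT x|M. (f x)\<^sup>2) powr (1/2) * (LINT x|M. (g x)\<^sup>2) powr (1/2)"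
    using H(2) f g by simp
  then have "(LINT x|M. \<bar>f x * g x\<bar>)\<^sup>2 \<le> ((LINT x|M. (f x)\<^sup>2) powr (1/2) * (LINT x|M. (g x)\<^sup>2) powr (1/2))\<^sup>2"
    by (rule power_mono) simp
  also have "\<dots> = (LINT x|M. (f x)\<^sup>2) * (LINT x|M. (g x)\<^sup>2)"
    by (simp add: power_mult_distrib powr_half_sqrt)
  finally show "(LINT x|M. \<bar>f x * g x\<bar>)\<^sup>2 \<le> (LINT x|M. (f x)\<^sup>2) * (LINT x|M. (g x)\<^sup>2)" .
qed

text \<open>On a short interval h(v) is nearly constant, so the mean value estimate for H and the
  increment formula for v give the bound with a slack e in the weight. Both sides are compatible
  with joining intervals, so bisection yields the bound on [a,b]; then e tends to 0. No pointwise
  derivative of v appears.\<close>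

lemma chain_rule_bound:
  fixes H h v g :: "real \<Rightarrow> real"
  assumes "a \<le> b" and H: "\<And>x. x \<in> S \<Longrightarrow> (H has_real_derivative h x) (at x within S)"
    and h: "continuous_on S h" and S: "convex S"
    and v: "continuous_on {a..b} v" and vS: "v ` {a..b} \<subseteq> S"
    and g: "integrable (lebesgue_on {a..b}) g"
    and vg: "\<And>s t. a \<le> s \<Longrightarrow> s \<le> t \<Longrightarrow> t \<le> b \<Longrightarrow> (LINT x|lebesgue_on {s..t}. g x) = v t - v s"
  shows "\<bar>H (v b) - H (v a)\<bar> \<le> (LINT x|lebesgue_on {a..b}. \<bar>h (v x)\<bar> * \<bar>g x\<bar>)"
proof -
  have hv: "continuous_on {a..b} (\<lambda>x. \<bar>h (v x)\<bar>)"
    by (intro continuous_intros continuous_on_compose2[OF h v] vS)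
  have gabs: "integrable (lebesgue_on {a..b}) (\<lambda>x. \<bar>g x\<bar>)" using g by (rule integrable_abs)
  have int: "integrable (lebesgue_on {a..b}) (\<lambda>x. (\<bar>h (v x)\<bar> + e) * \<bar>g x\<bar>)" for e
    by (intro integrable_continuous_mult continuous_intros hv gabs)
  have "\<bar>H (v b) - H (v a)\<bar> \<le> (LINT x|lebesgue_on {a..b}. (\<bar>h (v x)\<bar> + e) * \<bar>g x\<bar>)" if "e > 0" for e
  proof -
    \<comment> \<open>The range conditions are built into \<open>P\<close> because the local case of
      \<open>Bolzano\<close> also offers intervals that stick out of [a,b].\<close>
    define P where "P s t \<longleftrightarrow> (a \<le> s \<and> s \<le> t \<and> t \<le> b \<longrightarrow>
       \<bar>H (v t) - H (v s)\<bar> \<le> (LINT x|lebesgue_on {s..t}. (\<bar>h (v x)\<bar> + e) * \<bar>g x\<bar>))" for s t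
    have "P a b" using \<open>a \<le> b\<close>
    proof (induction rule: Bolzano)
      case (trans r s t)
      show ?case unfolding P_def
      proof
        assume *: "a \<le> r \<and> r \<le> t \<and> t \<le> b"
        have "integrable (lebesgue_on {r..t}) (\<lambda>x. (\<bar>h (v x)\<bar> + e) * \<bar>g x\<bar>)"
          using int by (rule integrable_subinterval) (use * in auto)
        from integral_combine[OF this trans(3,4)]
        show "\<bar>H (v t) - H (v r)\<bar> \<le> (LINT x|lebesgue_on {r..t}. (\<bar>h (v x)\<bar> + e) * \<bar>g x\<bar>)"
          using trans * unfolding P_def by linarith
      qed
    next
      case (local x)
      have xab: "x \<in> {a..b}" using local by auto
      have "continuous_on {a..b} (\<lambda>x. h (v x))"
        by (intro continuous_on_compose2[OF h v] vS)
      then obtain d where "d > 0" and d: "\<And>y. y \<in> {a..b} \<Longrightarrow> dist y x < d \<Longrightarrow> dist (h (v y)) (h (v x)) < e / 2"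
        using xab \<open>e > 0\<close> unfolding continuous_on_iff by (metis half_gt_zero)
      have "P s t" if st: "s \<le> x" "x \<le> t" "t - s < d" for s t
        unfolding P_def
      proof
        assume *: "a \<le> s \<and> s \<le> t \<and> t \<le> b"
        \<comment> \<open>On a short enough interval this constant lies between |h(v y)| and |h(v
          y)| + e for every y: the first bound serves the mean value estimate, the second the
          comparison of integrals.\<close>
        define C where "C = \<bar>h (v x)\<bar> + e / 2"
        have near: "\<bar>h (v y) - h (v x)\<bar> < e / 2" if "y \<in> {s..t}" for y
          using d[of y] that st * by (auto simp: dist_real_def)
        have vst: "continuous_on {s..t} v" using v by (rule continuous_on_subset) (use * in auto)
        have gst: "integrable (lebesgue_on {s..t}) g" using g by (rule integrable_subinterval) (use * in auto)
        \<comment> \<open>By the intermediate value theorem every point of the segment from v s to v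
          t is a value of v on [s,t], so the bound on h(v) over [s,t] is a bound on h over the whole
          segment.\<close>
        have vI: "\<exists>y\<in>{s..t}. v y = z" if z: "z \<in> closed_segment (v s) (v t)" for z
        proof -
          have "closed_segment s t = {s..t}" using * by (simp add: closed_segment_eq_real_ivl)
          then show ?thesis using IVT'_closed_segment_real[of z v s t] z vst by simp
        qed
        have sub: "closed_segment (v s) (v t) \<subseteq> S"
          using vS * by (intro closed_segment_subset S) auto
        have "norm (H (v t) - H (v s)) \<le> C * norm (v t - v s)"
        proof (rule field_differentiable_bound[where f' = h and S = "closed_segment (v s) (v t)"])
          fix z assume z: "z \<in> closed_segment (v s) (v t)"
          show "(H has_field_derivative h z) (at z within closed_segment (v s) (v t))"
            using H z sub by (meson DERIV_subset subsetD)
          obtain y where "y \<in> {s..t}" "v y = z" using vI[OF z] by auto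
          then have "\<bar>h z - h (v x)\<bar> < e / 2" using near by blast
          then show "norm (h z) \<le> C" unfolding C_def real_norm_def by linarith
        qed auto
        also have "\<dots> \<le> C * (LINT x|lebesgue_on {s..t}. \<bar>g x\<bar>)"
        proof (rule mult_left_mono)
          have "v t - v s = (LINT x|lebesgue_on {s..t}. g x)" using vg * by simp
          then show "norm (v t - v s) \<le> (LINT x|lebesgue_on {s..t}. \<bar>g x\<bar>)"
            using integral_norm_bound[of "lebesgue_on {s..t}" g] by simp
          show "0 \<le> C" using \<open>e > 0\<close> by (simp add: C_def)
        qed
        also have "C * (LINT x|lebesgue_on {s..t}. \<bar>g x\<bar>) = (LINT x|lebesgue_on {s..t}. C * \<bar>g x\<bar>)"
          by simp
        also have "\<dots> \<le> (LINT x|lebesgue_on {s..t}. (\<bar>h (v x)\<bar> + e) * \<bar>g x\<bar>)"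
        proof (rule integral_mono)
          show "integrable (lebesgue_on {s..t}) (\<lambda>x. C * \<bar>g x\<bar>)" using gst by auto
          show "integrable (lebesgue_on {s..t}) (\<lambda>x. (\<bar>h (v x)\<bar> + e) * \<bar>g x\<bar>)"
            using int by (rule integrable_subinterval) (use * in auto)
          fix y assume "y \<in> space (lebesgue_on {s..t})"
          then have "\<bar>h (v y) - h (v x)\<bar> < e / 2" using near by simp
          then have "C \<le> \<bar>h (v y)\<bar> + e" unfolding C_def by linarith
          then show "C * \<bar>g y\<bar> \<le> (\<bar>h (v y)\<bar> + e) * \<bar>g y\<bar>" by (rule mult_right_mono) simp
        qed
        finally show "\<bar>H (v t) - H (v s)\<bar> \<le> (LINT x|lebesgue_on {s..t}. (\<bar>h (v x)\<bar> + e) * \<bar>g x\<bar>)"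
          by simp
      qed
      then show ?case using \<open>d > 0\<close> by blast
    qed
    then show ?thesis using \<open>a \<le> b\<close> by (simp add: P_def)
  qed
  then have le: "\<bar>H (v b) - H (v a)\<bar> \<le> (LINT x|lebesgue_on {a..b}. \<bar>h (v x)\<bar> * \<bar>g x\<bar>) + e * (LINT x|lebesgue_on {a..b}. \<bar>g x\<bar>)"
    if "e > 0" for e
    using that int[of 0] gabs by (simp add: distrib_right)
  show ?thesis
  proof (rule field_le_epsilon)
    fix r :: real assume "r > 0"
    define I where "I = (LINT x|lebesgue_on {a..b}. \<bar>g x\<bar>)"
    have "I \<ge> 0" by (simp add: I_def)
    have "r / (I + 1) * I \<le> r" using \<open>r > 0\<close> \<open>I \<ge> 0\<close> by (simp add: field_simps)
    then show "\<bar>H (v b) - H (v a)\<bar> \<le> (LINT x|lebesgue_on {a..b}. \<bar>h (v x)\<bar> * \<bar>g x\<bar>) + r"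
      using le[of "r / (I + 1)"] \<open>r > 0\<close> \<open>I \<ge> 0\<close> unfolding I_def by auto
  qed
qed

section \<open>Antiperiodic solutions\<close>

lemma abs_continuous_imp_continuous_on:
  assumes "abs_continuous_on_interval a b f"
  shows "continuous_on {a..b} f"
  unfolding continuous_on_iff
proof (intro ballI allI impI)
  fix x e :: real assume x: "x \<in> {a..b}" and "0 < e"
  obtain d where "d > 0" and d: "\<And>D :: (real \<times> real) set.
        finite D \<and> (\<forall>(x, y)\<in>D. a \<le> x \<and> x \<le> y \<and> y \<le> b) \<and>
        disjoint_family_on (\<lambda>(x, y). {x<..<y}) D \<and> (\<Sum>(x, y)\<in>D. y - x) < d \<longrightarrow>
        (\<Sum>(x, y)\<in>D. \<bar>f y - f x\<bar>) < e"
    using assms \<open>0 < e\<close> unfolding abs_continuous_on_interval_def by blast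
  have "dist (f y) (f x) < e" if "y \<in> {a..b}" "dist y x < d" for y
    using d[of "{(min x y, max x y)}"] x that
    by (auto simp: dist_real_def disjoint_family_on_def min_def max_def abs_minus_commute split: if_splits)
  then show "\<exists>d>0. \<forall>y\<in>{a..b}. dist y x < d \<longrightarrow> dist (f y) (f x) < e"
    using \<open>d > 0\<close> by blast
qed

lemma lipschitz_imp_abs_continuous:
  assumes L: "\<And>x y. a \<le> x \<Longrightarrow> x \<le> y \<Longrightarrow> y \<le> b \<Longrightarrow> \<bar>f y - f x\<bar> \<le> L * (y - x)"
  shows "abs_continuous_on_interval a b f"
  unfolding abs_continuous_on_interval_def
proof (intro allI impI)
  fix e :: real assume "e > 0"
  define d where "d = e / (\<bar>L\<bar> + 1)"
  have "d > 0" using \<open>e > 0\<close> by (simp add: d_def)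
  have "(\<Sum>(x, y)\<in>D. \<bar>f y - f x\<bar>) < e"
    if D: "\<forall>(x, y)\<in>D. a \<le> x \<and> x \<le> y \<and> y \<le> b" "(\<Sum>(x, y)\<in>D. y - x) < d" for D :: "(real \<times> real) set"
  proof -
    have "(\<Sum>(x, y)\<in>D. \<bar>f y - f x\<bar>) \<le> (\<Sum>(x, y)\<in>D. (\<bar>L\<bar> + 1) * (y - x))"
    proof (rule sum_mono)
      fix t assume "t \<in> D"
      then obtain x y where t: "t = (x, y)" "a \<le> x" "x \<le> y" "y \<le> b" using D(1) by auto
      have "\<bar>f y - f x\<bar> \<le> L * (y - x)" using L t by blast
      also have "\<dots> \<le> (\<bar>L\<bar> + 1) * (y - x)" by (rule mult_right_mono) (use t in auto)
      finally show "(case t of (x, y) \<Rightarrow> \<bar>f y - f x\<bar>) \<le> (case t of (x, y) \<Rightarrow> (\<bar>L\<bar> + 1) * (y - x))"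
        by (simp add: t)
    qed
    also have "\<dots> = (\<bar>L\<bar> + 1) * (\<Sum>(x, y)\<in>D. y - x)" by (simp add: sum_distrib_left case_prod_unfold)
    also have "\<dots> < (\<bar>L\<bar> + 1) * d" using D(2) by (intro mult_strict_left_mono) auto
    also have "\<dots> = e" by (simp add: d_def)
    finally show ?thesis .
  qed
  then show "\<exists>\<delta>>0. \<forall>D. finite D \<and> (\<forall>(x, y)\<in>D. a \<le> x \<and> x \<le> y \<and> y \<le> b) \<and>
        disjoint_family_on (\<lambda>(x, y). {x<..<y}) D \<and> (\<Sum>(x, y)\<in>D. y - x) < \<delta> \<longrightarrow>
        (\<Sum>(x, y)\<in>D. \<bar>f y - f x\<bar>) < e"
    using \<open>d > 0\<close> by (intro exI[of _ d]) simp
qed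

lemma C1_imp_lipschitz:
  fixes u :: "real \<Rightarrow> real"
  assumes u: "\<And>t. t \<in> {a..b} \<Longrightarrow> (u has_real_derivative u' t) (at t within {a..b})"
    and B: "\<And>t. t \<in> {a..b} \<Longrightarrow> \<bar>u' t\<bar> \<le> B" and xy: "a \<le> x" "x \<le> y" "y \<le> b"
  shows "\<bar>u y - u x\<bar> \<le> B * (y - x)"
  using field_differentiable_bound[of "{a..b}" u u' B y x] assms by simp

text \<open>Meant for the product of a solution and its derivative, whose total increment is the
  boundary term of the energy identity.\<close>

lemma abs_continuous_mult:
  assumes f: "abs_continuous_on_interval a b f" and g: "abs_continuous_on_interval a b g"
  shows "abs_continuous_on_interval a b (\<lambda>x. f x * g x)"
  unfolding abs_continuous_on_interval_def
proof (intro allI impI)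
  fix e :: real assume "e > 0"
  obtain B1 where B1: "\<And>x. x \<in> {a..b} \<Longrightarrow> \<bar>f x\<bar> \<le> B1"
    using continuous_on_interval_bounded[OF abs_continuous_imp_continuous_on[OF f]] by blast
  obtain B2 where B2: "\<And>x. x \<in> {a..b} \<Longrightarrow> \<bar>g x\<bar> \<le> B2"
    using continuous_on_interval_bounded[OF abs_continuous_imp_continuous_on[OF g]] by blast
  define B where "B = max 1 (max B1 B2)"
  have B: "B \<ge> 1" "\<And>x. x \<in> {a..b} \<Longrightarrow> \<bar>f x\<bar> \<le> B" "\<And>x. x \<in> {a..b} \<Longrightarrow> \<bar>g x\<bar> \<le> B"
    using B1 B2 by (auto simp: B_def intro: le_max_iff_disj[THEN iffD2])
  define e' where "e' = e / (2 * B)"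
  have "e' > 0" using \<open>e > 0\<close> B(1) by (simp add: e'_def)
  have ac: "\<exists>d>0. \<forall>D :: (real \<times> real) set. finite D \<and> (\<forall>(x, y)\<in>D. a \<le> x \<and> x \<le> y \<and> y \<le> b) \<and>
        disjoint_family_on (\<lambda>(x, y). {x<..<y}) D \<and> (\<Sum>(x, y)\<in>D. y - x) < d \<longrightarrow>
        (\<Sum>(x, y)\<in>D. \<bar>h y - h x\<bar>) < e'" if "abs_continuous_on_interval a b h" for h
    using that \<open>e' > 0\<close> unfolding abs_continuous_on_interval_def by blast
  obtain d1 where d1: "d1 > 0" "\<And>D :: (real \<times> real) set. finite D \<and> (\<forall>(x, y)\<in>D. a \<le> x \<and> x \<le> y \<and> y \<le> b) \<and>
        disjoint_family_on (\<lambda>(x, y). {x<..<y}) D \<and> (\<Sum>(x, y)\<in>D. y - x) < d1 \<longrightarrow>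
        (\<Sum>(x, y)\<in>D. \<bar>f y - f x\<bar>) < e'" using ac[OF f] by blast
  obtain d2 where d2: "d2 > 0" "\<And>D :: (real \<times> real) set. finite D \<and> (\<forall>(x, y)\<in>D. a \<le> x \<and> x \<le> y \<and> y \<le> b) \<and>
        disjoint_family_on (\<lambda>(x, y). {x<..<y}) D \<and> (\<Sum>(x, y)\<in>D. y - x) < d2 \<longrightarrow>
        (\<Sum>(x, y)\<in>D. \<bar>g y - g x\<bar>) < e'" using ac[OF g] by blast
  have "(\<Sum>(x, y)\<in>D. \<bar>f y * g y - f x * g x\<bar>) < e"
    if D: "finite D \<and> (\<forall>(x, y)\<in>D. a \<le> x \<and> x \<le> y \<and> y \<le> b) \<and>
        disjoint_family_on (\<lambda>(x, y). {x<..<y}) D \<and> (\<Sum>(x, y)\<in>D. y - x) < min d1 d2" for D :: "(real \<times> real) set"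
  proof -
    have "(\<Sum>(x, y)\<in>D. \<bar>f y * g y - f x * g x\<bar>) \<le> (\<Sum>(x, y)\<in>D. B * \<bar>f y - f x\<bar> + B * \<bar>g y - g x\<bar>)"
    proof (rule sum_mono)
      fix t assume "t \<in> D"
      then obtain x y where t: "t = (x, y)" "x \<in> {a..b}" "y \<in> {a..b}" using D by fastforce
      have "\<bar>f y * g y - f x * g x\<bar> = \<bar>(f y - f x) * g y + f x * (g y - g x)\<bar>" by (simp add: algebra_simps)
      also have "\<dots> \<le> \<bar>f y - f x\<bar> * \<bar>g y\<bar> + \<bar>f x\<bar> * \<bar>g y - g x\<bar>"
        by (metis abs_mult abs_triangle_ineq)
      also have "\<dots> \<le> \<bar>f y - f x\<bar> * B + B * \<bar>g y - g x\<bar>"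
        using B t by (intro add_mono mult_left_mono mult_right_mono) auto
      finally show "(case t of (x, y) \<Rightarrow> \<bar>f y * g y - f x * g x\<bar>) \<le> (case t of (x, y) \<Rightarrow> B * \<bar>f y - f x\<bar> + B * \<bar>g y - g x\<bar>)"
        by (simp add: t mult.commute)
    qed
    also have "\<dots> = B * (\<Sum>(x, y)\<in>D. \<bar>f y - f x\<bar>) + B * (\<Sum>(x, y)\<in>D. \<bar>g y - g x\<bar>)"
      by (simp add: sum_distrib_left case_prod_unfold sum.distrib)
    also have "\<dots> < B * e' + B * e'"
      using d1(2)[of D] d2(2)[of D] D B(1) by (intro add_strict_mono mult_strict_left_mono) auto
    also have "\<dots> = e" using B(1) by (simp add: e'_def)
    finally show ?thesis .
  qed
  then show "\<exists>\<delta>>0. \<forall>D. finite D \<and> (\<forall>(x, y)\<in>D. a \<le> x \<and> x \<le> y \<and> y \<le> b) \<and>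
        disjoint_family_on (\<lambda>(x, y). {x<..<y}) D \<and> (\<Sum>(x, y)\<in>D. y - x) < \<delta> \<longrightarrow>
        (\<Sum>(x, y)\<in>D. \<bar>f y * g y - f x * g x\<bar>) < e"
    using d1(1) d2(1) by (intro exI[of _ "min d1 d2"]) simp
qed

section \<open>Square-integrable functions and the Sobolev space\<close>

lemma Lp_space_2_iff:
  "f \<in> Lp_space T 2 \<longleftrightarrow> f \<in> borel_measurable (lebesgue_on {0..T}) \<and> integrable (lebesgue_on {0..T}) (\<lambda>t. (f t)\<^sup>2)"
  by (simp add: Lp_space_def)

lemma continuous_imp_Lp_space_2:
  assumes "continuous_on {0..T} f"
  shows "f \<in> Lp_space T 2"
  unfolding Lp_space_2_iff
  by (intro conjI continuous_imp_measurable_on_sets_lebesgue assms continuous_imp_integrable_real continuous_intros) auto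

lemma Lp_space_2_integrable:
  assumes "f \<in> Lp_space T 2"
  shows "integrable (lebesgue_on {0..T}) f"
proof -
  have "integrable (lebesgue_on {0..T}) (\<lambda>x. f x * 1)"
    by (rule Cauchy_Schwarz_integral(1)) (use assms[unfolded Lp_space_2_iff] in auto)
  then show ?thesis by simp
qed

lemma H1_weak_deriv:
  assumes "w \<in> H1 T"
  shows "weak_deriv T w \<in> Lp_space T 2" "has_weak_derivative T w (weak_deriv T w)"
  using someI_ex[of "\<lambda>g. g \<in> Lp_space T 2 \<and> has_weak_derivative T w g"] assms
  by (auto simp: H1_def weak_deriv_def)

lemma H1_weak_deriv_integral:
  assumes "0 < T" "w \<in> H1 T" "0 \<le> s" "s \<le> t" "t \<le> T"
  shows "(LINT x|lebesgue_on {s..t}. weak_deriv T w x) = w t - w s"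
  by (rule weak_derivative_integral[OF assms(1) _ Lp_space_2_integrable])
    (use assms H1_weak_deriv[OF assms(2)] in \<open>auto simp: H1_def\<close>)

text \<open>\<open>weak_deriv\<close> is an arbitrary choice, so the second claim rests on
  uniqueness: the chosen function and u' have the same integral over every [s,T], namely u T - u
  s.\<close>

lemma C1_in_H1:
  assumes T: "0 < T" and u: "\<And>t. t \<in> {0..T} \<Longrightarrow> (u has_real_derivative u' t) (at t within {0..T})"
    and u': "continuous_on {0..T} u'"
  shows "u \<in> H1 T" "(LINT t|lebesgue_on {0..T}. (weak_deriv T u t)\<^sup>2) = (LINT t|lebesgue_on {0..T}. (u' t)\<^sup>2)"
proof -
  have weak: "has_weak_derivative T u u'" by (rule has_weak_derivative_C1[OF T u u'])
  have cont: "continuous_on {0..T} u" by (rule DERIV_continuous_on[OF u])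
  show H1: "u \<in> H1 T"
    using weak continuous_imp_Lp_space_2 cont u' by (auto simp: H1_def)
  have int: "integrable (lebesgue_on {0..T}) (weak_deriv T u)" "integrable (lebesgue_on {0..T}) u'"
    using H1_weak_deriv(1)[OF H1] u' by (auto intro: Lp_space_2_integrable continuous_imp_integrable_real)
  have "AE x in lebesgue_on {0..T}. weak_deriv T u x = u' x"
  proof (rule AE_eq_if_interval_integrals_eq[OF int])
    fix s assume "0 \<le> s" "s \<le> T"
    then show "(LINT x|lebesgue_on {s..T}. weak_deriv T u x) = (LINT x|lebesgue_on {s..T}. u' x)"
      using H1_weak_deriv_integral[OF T H1, of s T] weak_derivative_integral[OF T cont int(2) weak, of s T] by simp
  qed
  then show "(LINT t|lebesgue_on {0..T}. (weak_deriv T u t)\<^sup>2) = (LINT t|lebesgue_on {0..T}. (u' t)\<^sup>2)"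
    using int by (intro integral_cong_AE) auto
qed

text \<open>Almost everywhere the derivative of u u' is u'^2 - a u^2. The boundary term is zero
  because both factors change sign from 0 to T, so their product takes the same value at both
  ends.\<close>

lemma antiperiodic_solution_energy:
  assumes T: "0 < T" and sol: "antiperiodic_solution T a u" and a: "integrable (lebesgue_on {0..T}) a"
  obtains u' where "\<And>t. t \<in> {0..T} \<Longrightarrow> (u has_real_derivative u' t) (at t within {0..T})"
    "continuous_on {0..T} u'"
    "(LINT t|lebesgue_on {0..T}. (u' t)\<^sup>2) = (LINT t|lebesgue_on {0..T}. a t * (u t)\<^sup>2)"
proof -
  obtain u' where u: "\<And>t. t \<in> {0..T} \<Longrightarrow> (u has_real_derivative u' t) (at t within {0..T})"
    and ac: "abs_continuous_on_interval 0 T u'"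
    and ae: "AE t in lebesgue_on {0..T}. \<exists>u''. (u' has_real_derivative u'') (at t within {0..T}) \<and> u'' + a t * u t = 0"
    and bd: "u 0 + u T = 0" "u' 0 + u' T = 0"
    using sol unfolding antiperiodic_solution_def by blast
  have cu': "continuous_on {0..T} u'" using ac by (rule abs_continuous_imp_continuous_on)
  have cu: "continuous_on {0..T} u" by (rule DERIV_continuous_on[OF u])
  obtain B where B: "\<And>t. t \<in> {0..T} \<Longrightarrow> \<bar>u' t\<bar> \<le> B"
    using continuous_on_interval_bounded[OF cu'] by blast
  have acu: "abs_continuous_on_interval 0 T u"
    by (rule lipschitz_imp_abs_continuous[OF C1_imp_lipschitz[OF u B]])
  obtain N where N: "N \<in> null_sets lebesgue" and der: "\<And>t. t \<in> {0..T} - N \<Longrightarrow>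
      \<exists>u''. (u' has_real_derivative u'') (at t within {0..T}) \<and> u'' + a t * u t = 0"
  proof -
    have "AE t in lebesgue. t \<in> {0..T} \<longrightarrow>
        (\<exists>u''. (u' has_real_derivative u'') (at t within {0..T}) \<and> u'' + a t * u t = 0)"
      using ae by (subst (asm) AE_restrict_space_iff) auto
    then show thesis
      by (rule AE_E3) (rule that, auto)
  qed
  have "((\<lambda>t. (u' t)\<^sup>2 - a t * (u t)\<^sup>2) has_integral (u T * u' T - u 0 * u' 0)) {0..T}"
  proof (rule abs_continuous_has_integral[OF _ abs_continuous_mult[OF acu ac] N])
    fix t assume t: "t \<in> {0..T} - N"
    obtain u'' where u'': "(u' has_real_derivative u'') (at t within {0..T})" "u'' + a t * u t = 0"
      using der[OF t] by blast
    have "((\<lambda>t. u t * u' t) has_real_derivative u t * u'' + u' t * u' t) (at t within {0..T})"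
      by (rule DERIV_mult'[OF u u''(1)]) (use t in auto)
    also have "u t * u'' + u' t * u' t = (u' t)\<^sup>2 - a t * (u t)\<^sup>2"
    proof -
      have "u'' = - (a t * u t)" using u''(2) by linarith
      then show ?thesis by (simp add: power2_eq_square)
    qed
    finally show "((\<lambda>t. u t * u' t) has_real_derivative (u' t)\<^sup>2 - a t * (u t)\<^sup>2) (at t within {0..T})" .
  qed (use T in auto)
  moreover have "u T * u' T - u 0 * u' 0 = 0"
  proof -
    have "u T = - u 0" "u' T = - u' 0" using bd by linarith+
    then show ?thesis by simp
  qed
  moreover have i1: "integrable (lebesgue_on {0..T}) (\<lambda>t. (u' t)\<^sup>2)"
    by (intro continuous_imp_integrable_real continuous_intros cu')
  moreover have i2: "integrable (lebesgue_on {0..T}) (\<lambda>t. a t * (u t)\<^sup>2)"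
    using integrable_continuous_mult[OF continuous_on_power[OF cu] a] by (simp add: mult.commute)
  ultimately have "(LINT t|lebesgue_on {0..T}. (u' t)\<^sup>2 - a t * (u t)\<^sup>2) = 0"
    by (subst lebesgue_integral_eq_integral) (auto simp: integral_unique)
  then have "(LINT t|lebesgue_on {0..T}. (u' t)\<^sup>2) = (LINT t|lebesgue_on {0..T}. a t * (u t)\<^sup>2)"
    using i1 i2 by simp
  then show thesis using that u cu' by blast
qed

section \<open>Essential suprema on the interval\<close>

lemma not_AE_False_interval:
  fixes T :: real
  assumes "0 < T"
  shows "\<not> (AE t in lebesgue_on {0..T}. False)"
  using assms ae_filter_eq_bot_iff[of "lebesgue_on {0..T}"]
  by (simp add: eventually_False emeasure_restrict_space)

lemma L_infinity_norm:
  assumes T: "0 < T" and f: "f \<in> Lp_space T \<infinity>"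
  shows "AE t in lebesgue_on {0..T}. \<bar>f t\<bar> \<le> Lp_norm T \<infinity> f" "0 \<le> Lp_norm T \<infinity> f"
proof -
  define E where "E = esssup (lebesgue_on {0..T}) (\<lambda>t. ereal \<bar>f t\<bar>)"
  have ae: "AE t in lebesgue_on {0..T}. ereal \<bar>f t\<bar> \<le> E" unfolding E_def by (rule esssup_AE)
  \<comment> \<open>\<open>Lp_norm\<close> passes through \<open>real_of_ereal\<close>, which sends
    both infinities to 0, so \<open>E\<close> must first be located in [0, \<infinity>). A negative
    value is excluded because the interval is not a null set.\<close>
  have "E < \<infinity>" using f by (simp add: Lp_space_def E_def)
  moreover have "0 \<le> E"
  proof (rule ccontr)
    assume "\<not> 0 \<le> E"
    from ae have "AE t in lebesgue_on {0..T}. False"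
    proof eventually_elim
      case (elim t)
      then have "0 \<le> E" by (rule order_trans[rotated]) simp
      then show False using \<open>\<not> 0 \<le> E\<close> by simp
    qed
    then show False using not_AE_False_interval[OF T] by contradiction
  qed
  ultimately obtain r where r: "E = ereal r" "r \<ge> 0" by (cases E) auto
  have n: "Lp_norm T \<infinity> f = r" using r by (simp add: Lp_norm_def E_def)
  show "AE t in lebesgue_on {0..T}. \<bar>f t\<bar> \<le> Lp_norm T \<infinity> f" using ae by (simp add: n r)
  show "0 \<le> Lp_norm T \<infinity> f" using r n by simp
qed

lemma L_infinity_norm_le:
  assumes T: "0 < T" and f: "f \<in> borel_measurable (lebesgue_on {0..T})"
    and B: "AE t in lebesgue_on {0..T}. \<bar>f t\<bar> \<le> B"
  shows "f \<in> Lp_space T \<infinity>" "Lp_norm T \<infinity> f \<le> B"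
proof -
  define E where "E = esssup (lebesgue_on {0..T}) (\<lambda>t. ereal \<bar>f t\<bar>)"
  have "E \<le> ereal B" unfolding E_def using f B by (intro esssup_I) auto
  then have "E < \<infinity>" by (rule order.strict_trans1) simp
  then show mem: "f \<in> Lp_space T \<infinity>" using f by (simp add: Lp_space_def E_def)
  have "0 \<le> Lp_norm T \<infinity> f" by (rule L_infinity_norm(2)[OF T mem])
  moreover have "B \<ge> 0"
  proof (rule ccontr)
    assume "\<not> B \<ge> 0"
    from B have "AE t in lebesgue_on {0..T}. False"
      by eventually_elim (use \<open>\<not> B \<ge> 0\<close> in linarith)
    then show False using not_AE_False_interval[OF T] by contradiction
  qed
  ultimately show "Lp_norm T \<infinity> f \<le> B"
    using \<open>E \<le> ereal B\<close> by (cases E) (auto simp: Lp_norm_def E_def)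
qed

text \<open>The excess max 0 (f - B) is continuous, nonnegative and has integral zero, so it
  vanishes everywhere. This lets essential suprema control point values of continuous
  functions.\<close>

lemma continuous_AE_le_imp_le:
  fixes f :: "real \<Rightarrow> real"
  assumes T: "0 < T" and f: "continuous_on {0..T} f" and ae: "AE t in lebesgue_on {0..T}. f t \<le> B"
    and t: "t \<in> {0..T}"
  shows "f t \<le> B"
proof -
  have c: "continuous_on {0..T} (\<lambda>t. max 0 (f t - B))" by (intro continuous_intros f)
  have "(LINT t|lebesgue_on {0..T}. max 0 (f t - B)) = 0"
    by (rule integral_eq_zero_AE) (use ae in \<open>auto elim!: eventually_mono\<close>)
  then have "\<forall>t\<in>{0..T}. max 0 (f t - B) = 0"
    using integralL_eq_0_iff[OF c T] by simp
  then show ?thesis using t by (metis diff_le_0_iff_le max.cobounded2)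
qed

text \<open>In all three cases this is the norm of v^2 in the space with the exponent conjugate to
  p, which is what Hoelder pairs with the \<open>Lp_norm\<close> of a potential.\<close>

definition I_ant_denominator :: "real \<Rightarrow> ereal \<Rightarrow> (real \<Rightarrow> real) \<Rightarrow> real" where
  "I_ant_denominator T p v =
     (if p = 1 then (Lp_norm T \<infinity> v)\<^sup>2
      else if p = \<infinity> then (LINT t|lebesgue_on {0..T}. (v t)\<^sup>2)
      else (let q = real_of_ereal p in
             (LINT t|lebesgue_on {0..T}. \<bar>v t\<bar> powr (2 * q / (q - 1))) powr ((q - 1) / q)))"

lemma I_ant_eq: "I_ant T p v = (LINT t|lebesgue_on {0..T}. (weak_deriv T v t)\<^sup>2) / I_ant_denominator T p v"
  by (simp add: I_ant_def I_ant_denominator_def)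

lemma I_ant_denominator_nonneg: "0 \<le> I_ant_denominator T p v"
  by (simp add: I_ant_denominator_def Let_def)

lemma continuous_L_infinity:
  assumes T: "0 < T" and u: "continuous_on {0..T} u" and B: "\<And>t. t \<in> {0..T} \<Longrightarrow> \<bar>u t\<bar> \<le> B"
  shows "u \<in> Lp_space T \<infinity>" "Lp_norm T \<infinity> u \<le> B"
proof -
  have "u \<in> borel_measurable (lebesgue_on {0..T})"
    using u by (rule continuous_imp_measurable_on_sets_lebesgue) auto
  moreover have "AE t in lebesgue_on {0..T}. \<bar>u t\<bar> \<le> B" by (rule AE_I2) (use B in auto)
  ultimately show "u \<in> Lp_space T \<infinity>" "Lp_norm T \<infinity> u \<le> B" using L_infinity_norm_le[OF T] by blast+
qed

lemma positive_part_in_Lp_space: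
  assumes T: "0 < T" and p: "1 \<le> p" and a: "a \<in> Lp_space T p"
  shows "(\<lambda>t. max (a t) 0) \<in> Lp_space T p"
proof -
  have am: "a \<in> borel_measurable (lebesgue_on {0..T})" using a by (simp add: Lp_space_def)
  then have m: "(\<lambda>t. max (a t) 0) \<in> borel_measurable (lebesgue_on {0..T})" by measurable
  show ?thesis
  proof (cases "p = \<infinity>")
    case True
    have "AE t in lebesgue_on {0..T}. \<bar>max (a t) 0\<bar> \<le> Lp_norm T \<infinity> a"
      using L_infinity_norm(1)[OF T a[unfolded True]] by eventually_elim auto
    then show ?thesis using L_infinity_norm_le(1)[OF T m] True by simp
  next
    case False
    have i: "integrable (lebesgue_on {0..T}) (\<lambda>t. \<bar>a t\<bar> powr real_of_ereal p)"
      using a False by (simp add: Lp_space_def)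
    have "real_of_ereal p \<ge> 0" using p False by (cases p) auto
    then have "integrable (lebesgue_on {0..T}) (\<lambda>t. \<bar>max (a t) 0\<bar> powr real_of_ereal p)"
      by (intro Bochner_Integration.integrable_bound[OF i])
        (use m in \<open>auto intro!: powr_mono2 AE_I2\<close>)
    then show ?thesis using m False by (simp add: Lp_space_def)
  qed
qed

lemma Lp_norm_nonneg:
  assumes "0 < T" "f \<in> Lp_space T p"
  shows "0 \<le> Lp_norm T p f"
  using L_infinity_norm(2)[of T f] assms by (cases "p = \<infinity>") (auto simp: Lp_norm_def)

text \<open>Hoelder for the pair b and u^2. For p = 1 and p = \<infinity> one factor is bounded
  almost everywhere by its essential supremum; otherwise the conjugate exponent q/(q-1), applied to
  u^2, becomes 2q/(q-1) on |u|.\<close>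

lemma weighted_integral_le_norm_times_denominator:
  assumes T: "0 < T" and p: "1 \<le> p" and b: "b \<in> Lp_space T p" and b0: "\<And>t. 0 \<le> b t"
    and bi: "integrable (lebesgue_on {0..T}) b" and u: "continuous_on {0..T} u"
  shows "(LINT t|lebesgue_on {0..T}. b t * (u t)\<^sup>2) \<le> Lp_norm T p b * I_ant_denominator T p u"
proof -
  have bm: "b \<in> borel_measurable (lebesgue_on {0..T})" using bi by auto
  have um: "u \<in> borel_measurable (lebesgue_on {0..T})"
    using u by (rule continuous_imp_measurable_on_sets_lebesgue) auto
  have u2: "continuous_on {0..T} (\<lambda>t. (u t)\<^sup>2)" by (intro continuous_intros u)
  have int: "integrable (lebesgue_on {0..T}) (\<lambda>t. b t * (u t)\<^sup>2)"
    using integrable_continuous_mult[OF u2 bi] by (simp add: mult.commute)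
  consider "p = 1" | "p = \<infinity>" | q where "p = ereal q" "1 < q"
    using p by (cases p) (auto simp: one_ereal_def le_less)
  then show ?thesis
  proof cases
    case 1
    obtain B where "\<And>t. t \<in> {0..T} \<Longrightarrow> \<bar>u t\<bar> \<le> B" using continuous_on_interval_bounded[OF u] by blast
    then have ui: "u \<in> Lp_space T \<infinity>" by (rule continuous_L_infinity[OF T u])
    define N where "N = Lp_norm T \<infinity> u"
    have "(LINT t|lebesgue_on {0..T}. b t * (u t)\<^sup>2) \<le> (LINT t|lebesgue_on {0..T}. b t * N\<^sup>2)"
    proof (rule integral_mono_AE[OF int])
      show "AE t in lebesgue_on {0..T}. b t * (u t)\<^sup>2 \<le> b t * N\<^sup>2"
        using L_infinity_norm(1)[OF T ui]
      proof eventually_elim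
        case (elim t)
        then have "(u t)\<^sup>2 \<le> N\<^sup>2" unfolding N_def using L_infinity_norm(2)[OF T ui] by (simp add: abs_le_square_iff[symmetric])
        then show ?case using b0 by (rule mult_left_mono)
      qed
    qed (use bi in auto)
    also have "\<dots> = Lp_norm T p b * I_ant_denominator T p u"
      using 1 b0 by (simp add: Lp_norm_def I_ant_denominator_def N_def)
    finally show ?thesis .
  next
    case 2
    define K where "K = Lp_norm T \<infinity> b"
    have "(LINT t|lebesgue_on {0..T}. b t * (u t)\<^sup>2) \<le> (LINT t|lebesgue_on {0..T}. K * (u t)\<^sup>2)"
    proof (rule integral_mono_AE[OF int])
      show "integrable (lebesgue_on {0..T}) (\<lambda>t. K * (u t)\<^sup>2)"
        using continuous_imp_integrable_real[OF u2] by simp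
      show "AE t in lebesgue_on {0..T}. b t * (u t)\<^sup>2 \<le> K * (u t)\<^sup>2"
        using L_infinity_norm(1)[OF T b[unfolded 2]]
        by eventually_elim (auto simp: K_def intro: mult_right_mono)
    qed
    also have "\<dots> = Lp_norm T p b * I_ant_denominator T p u"
      using 2 by (simp add: I_ant_denominator_def K_def)
    finally show ?thesis .
  next
    case 3
    have q: "1 < q / (q - 1)" "1 / q + 1 / (q / (q - 1)) = 1" using 3 by (auto simp: field_simps)
    have pw: "\<bar>(u t)\<^sup>2\<bar> powr (q / (q - 1)) = \<bar>u t\<bar> powr (2 * q / (q - 1))" for t
    proof -
      have "\<bar>(u t)\<^sup>2\<bar> = \<bar>u t\<bar> powr 2" by simp
      then show ?thesis by (simp only: powr_powr) simp
    qed
    have "continuous_on {0..T} (\<lambda>t. \<bar>u t\<bar> powr (2 * q / (q - 1)))"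
      using 3 by (intro continuous_on_abs_powr u) auto
    then have i: "integrable (lebesgue_on {0..T}) (\<lambda>t. \<bar>(u t)\<^sup>2\<bar> powr (q / (q - 1)))"
      unfolding pw by (rule continuous_imp_integrable_real)
    have "(LINT t|lebesgue_on {0..T}. b t * (u t)\<^sup>2) = (LINT t|lebesgue_on {0..T}. \<bar>b t * (u t)\<^sup>2\<bar>)"
      using b0 by simp
    also have "\<dots> \<le> (LINT x|lebesgue_on {0..T}. \<bar>b x\<bar> powr q) powr (1/q) *
         (LINT x|lebesgue_on {0..T}. \<bar>(u x)\<^sup>2\<bar> powr (q / (q - 1))) powr (1/(q / (q - 1)))"
      by (rule Holder_integral(2)[OF 3(2) q bm _ _ i]) (use b 3 um in \<open>auto simp: Lp_space_def\<close>)
    also have "\<dots> = Lp_norm T p b * I_ant_denominator T p u"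
      unfolding pw using 3 by (simp add: Lp_norm_def I_ant_denominator_def Let_def one_ereal_def)
    finally show ?thesis .
  qed
qed

lemma Lambda_ant_norm_ge:
  assumes T: "0 < T" and p: "1 \<le> p" and a: "a \<in> Lambda_ant T" "a \<in> Lp_space T p"
  shows "\<exists>u\<in>X_ant_nonzero T. I_ant T p u \<le> Lp_norm T p (\<lambda>t. max (a t) 0)"
proof -
  obtain u where sol: "antiperiodic_solution T a u" and nz: "\<exists>t\<in>{0..T}. u t \<noteq> 0"
    and aL: "a \<in> Lp_space T 1"
    using a(1) by (auto simp: Lambda_ant_def L_periodic_def)
  have am: "a \<in> borel_measurable (lebesgue_on {0..T})" using aL by (simp add: Lp_space_def)
  have "integrable (lebesgue_on {0..T}) (\<lambda>t. \<bar>a t\<bar>)" using aL by (simp add: Lp_space_def)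
  then have ai: "integrable (lebesgue_on {0..T}) a" using integrable_abs_cancel am by blast
  obtain u' where u: "\<And>t. t \<in> {0..T} \<Longrightarrow> (u has_real_derivative u' t) (at t within {0..T})"
    and cu': "continuous_on {0..T} u'"
    and en: "(LINT t|lebesgue_on {0..T}. (u' t)\<^sup>2) = (LINT t|lebesgue_on {0..T}. a t * (u t)\<^sup>2)"
    using antiperiodic_solution_energy[OF T sol ai] by blast
  have cu: "continuous_on {0..T} u" by (rule DERIV_continuous_on[OF u])
  note H1 = C1_in_H1[OF T u cu']
  have X: "u \<in> X_ant_nonzero T"
    using H1(1) nz sol by (auto simp: X_ant_nonzero_def X_ant_def antiperiodic_solution_def)
  define b where "b t = max (a t) 0" for t
  have bi: "integrable (lebesgue_on {0..T}) b" unfolding b_def using ai by auto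
  have bL: "b \<in> Lp_space T p" unfolding b_def by (rule positive_part_in_Lp_space[OF T p a(2)])
  have u2: "continuous_on {0..T} (\<lambda>t. (u t)\<^sup>2)" by (intro continuous_intros cu)
  have "(LINT t|lebesgue_on {0..T}. (weak_deriv T u t)\<^sup>2) = (LINT t|lebesgue_on {0..T}. a t * (u t)\<^sup>2)"
    using H1(2) en by simp
  also have "\<dots> \<le> (LINT t|lebesgue_on {0..T}. b t * (u t)\<^sup>2)"
    by (rule integral_mono)
      (use integrable_continuous_mult[OF u2 ai] integrable_continuous_mult[OF u2 bi] in
        \<open>auto simp: b_def mult.commute intro!: mult_right_mono\<close>)
  also have "\<dots> \<le> Lp_norm T p b * I_ant_denominator T p u"
    by (rule weighted_integral_le_norm_times_denominator[OF T p bL _ bi cu]) (simp add: b_def)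
  finally have le: "(LINT t|lebesgue_on {0..T}. (weak_deriv T u t)\<^sup>2) \<le> Lp_norm T p b * I_ant_denominator T p u" .
  have "I_ant T p u \<le> Lp_norm T p b"
  proof (cases "I_ant_denominator T p u = 0")
    \<comment> \<open>Division by zero yields 0, so the quotient is 0 here and nonnegativity of the
      norm suffices.\<close>
    case True
    then show ?thesis using Lp_norm_nonneg[OF T bL] by (simp add: I_ant_eq)
  next
    case False
    then have "0 < I_ant_denominator T p u" using I_ant_denominator_nonneg[of T p u] by linarith
    then show ?thesis using le by (simp add: I_ant_eq pos_divide_le_eq)
  qed
  then show ?thesis using X by (auto simp: b_def[abs_def])
qed

section \<open>The generalized sine function\<close>

text \<open>D is the difference quotient of the r-th power at 1, with its removable singularity
  filled by r. With r = q/2 at the point sin^2 x it factors 1 - |sin x|^q as cos^2 x times a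
  positive continuous function, isolating the zeros of the square root.\<close>

lemma powr_difference_quotient:
  fixes r :: real
  assumes r: "1 \<le> r"
  obtains D :: "real \<Rightarrow> real" where "continuous_on UNIV D"
    "\<And>x. 0 \<le> x \<Longrightarrow> x \<le> 1 \<Longrightarrow> 0 < D x" "\<And>x. 0 \<le> x \<Longrightarrow> (1 - x) * D x = 1 - x powr r"
proof -
  define D where "D x = (if x = 1 then r else (1 - \<bar>x\<bar> powr r) / (1 - x))" for x :: real
  have "isCont D x" for x
  proof (cases "x = 1")
    case True
    have "((\<lambda>x. x powr r) has_real_derivative r * 1 powr (r - 1)) (at 1)"
      by (rule has_real_derivative_powr) simp
    then have "((\<lambda>y. (y powr r - 1) / (y - 1)) \<longlongrightarrow> r) (at 1)"
      by (simp add: has_field_derivative_iff)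
    moreover have "\<forall>\<^sub>F y in at 1. (y powr r - 1) / (y - 1) = D y"
      unfolding eventually_at
      by (rule exI[of _ 1]) (auto simp: D_def dist_real_def abs_if divide_simps algebra_simps split: if_splits)
    ultimately have "(D \<longlongrightarrow> r) (at 1)" by (rule Lim_transform_eventually)
    then show ?thesis using True by (simp add: isCont_def D_def)
  next
    case False
    have "continuous_on (- {1}) (\<lambda>x. (1 - \<bar>x\<bar> powr r) / (1 - x))"
      using r by (intro continuous_intros continuous_on_powr') auto
    then have "continuous_on (- {1}) D"
      by (rule continuous_on_eq) (auto simp: D_def)
    then show ?thesis using False by (simp add: continuous_on_eq_continuous_at open_Compl)
  qed
  moreover have "0 < D x" if x: "0 \<le> x" "x \<le> 1" for x
  proof (cases "x = 1")
    case False
    then have "x powr r < 1 powr r" using x r by (intro powr_less_mono2) auto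
    then show ?thesis using False x by (simp add: D_def)
  qed (use r in \<open>simp add: D_def\<close>)
  moreover have "(1 - x) * D x = 1 - x powr r" if "0 \<le> x" for x using that by (simp add: D_def)
  ultimately show thesis using that[of D] by (simp add: continuous_at_imp_continuous_on)
qed

text \<open>Separation of variables: \<Theta> solves the autonomous equation y' = 1 / m(y) with y(0)
  = 0. The lower bound c makes \<tau> grow at least linearly in both directions, so \<tau> is onto
  and the solution is global.\<close>

lemma strictly_increasing_reparametrization:
  fixes m :: "real \<Rightarrow> real"
  assumes m: "continuous_on UNIV m" "\<And>x. c \<le> m x" and c: "0 < c"
  obtains \<tau> \<Theta> :: "real \<Rightarrow> real" where "\<And>x. (\<tau> has_real_derivative m x) (at x)" "\<tau> 0 = 0"
    "\<And>x y. x < y \<Longrightarrow> \<tau> x < \<tau> y"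
    "\<And>s. \<tau> (\<Theta> s) = s" "\<And>x. \<Theta> (\<tau> x) = x" "\<And>s. (\<Theta> has_real_derivative inverse (m (\<Theta> s))) (at s)"
proof -
  have "\<exists>F. \<forall>x :: real. -\<infinity> < ereal x \<longrightarrow> x < \<infinity> \<longrightarrow> (F has_vector_derivative m x) (at x)"
    by (rule einterval_antiderivative) (use m(1) in \<open>auto simp: continuous_on_eq_continuous_at\<close>)
  then obtain F where F: "\<And>x. (F has_real_derivative m x) (at x)"
    by (auto simp: has_real_derivative_iff_has_vector_derivative)
  define \<tau> where "\<tau> x = F x - F 0" for x
  have D: "(\<tau> has_real_derivative m x) (at x)" for x
    unfolding \<tau>_def using F[of x] by (auto intro!: derivative_eq_intros)
  have mono: "\<tau> x < \<tau> y" if "x < y" for x y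
    by (rule DERIV_pos_imp_increasing[OF that]) (use D m(2) c in \<open>meson less_le_trans\<close>)
  have inj: "x = y" if "\<tau> x = \<tau> y" for x y
    using mono[of x y] mono[of y x] that by (cases x y rule: linorder_cases) auto
  have lin: "\<tau> x - c * x \<le> \<tau> y - c * y" if "x \<le> y" for x y
  proof (rule DERIV_nonneg_imp_nondecreasing[OF that])
    fix z
    show "\<exists>d. ((\<lambda>x. \<tau> x - c * x) has_real_derivative d) (at z) \<and> 0 \<le> d"
      using D[of z] m(2)[of z] by (intro exI[of _ "m z - c"]) (auto intro!: derivative_eq_intros)
  qed
  have cont: "isCont \<tau> x" for x using D by (rule DERIV_isCont)
  have surj: "\<exists>x. \<tau> x = s" for s
  proof -
    have 0: "\<tau> 0 = 0" by (simp add: \<tau>_def)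
    have "\<bar>s\<bar> \<le> \<tau> (\<bar>s\<bar> / c)" "\<tau> (- (\<bar>s\<bar> / c)) \<le> - \<bar>s\<bar>"
      using lin[of 0 "\<bar>s\<bar> / c"] lin[of "- (\<bar>s\<bar> / c)" 0] c 0 by auto
    then have "\<tau> (- (\<bar>s\<bar> / c)) \<le> s" "s \<le> \<tau> (\<bar>s\<bar> / c)" by linarith+
    moreover have "- (\<bar>s\<bar> / c) \<le> \<bar>s\<bar> / c" using c by simp
    ultimately show ?thesis using IVT[of \<tau> "- (\<bar>s\<bar> / c)" s "\<bar>s\<bar> / c"] cont by blast
  qed
  define \<Theta> where "\<Theta> s = (SOME x. \<tau> x = s)" for s
  have \<tau>\<Theta>: "\<tau> (\<Theta> s) = s" for s unfolding \<Theta>_def using surj[of s] by (rule someI_ex)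
  have \<Theta>\<tau>: "\<Theta> (\<tau> x) = x" for x using inj \<tau>\<Theta> by blast
  have "isCont \<Theta> (\<tau> x)" for x
    by (rule isCont_inverse_function[of 1]) (auto simp: \<Theta>\<tau> cont)
  then have cont\<Theta>: "isCont \<Theta> s" for s using \<tau>\<Theta>[of s] by metis
  have D\<Theta>: "(\<Theta> has_real_derivative inverse (m (\<Theta> s))) (at s)" for s
    by (rule DERIV_inverse_function[where f = \<tau> and a = "s - 1" and b = "s + 1"])
      (use D \<tau>\<Theta> cont\<Theta> m(2)[of "\<Theta> s"] c in auto)
  have "\<tau> 0 = 0" by (simp add: \<tau>_def)
  from that[of \<tau> \<Theta>, OF D this mono \<tau>\<Theta> \<Theta>\<tau> D\<Theta>] show thesis by blast
qed

text \<open>Substituting \<open>s = sin x\<close> turns the singular integrand of \<open>\<integral> ds / sqrt (1 - \<bar>s\<bar> powr q)\<close> into the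
  continuous function \<open>1 / R x\<close> below, so that \<open>u\<close> arises globally as \<open>sin\<close> of an inverse function.\<close>

lemma generalized_sine_exists:
  fixes T q :: real
  assumes T: "0 < T" and q: "2 \<le> q"
  obtains u u' :: "real \<Rightarrow> real" and \<omega> t0 :: real where "0 < \<omega>" "0 < t0" "t0 < T"
    "\<And>t. (u has_real_derivative u' t) (at t)" "continuous_on UNIV u'"
    "\<And>t. u (t + T) = - u t" "\<And>t. u' (t + T) = - u' t"
    "u 0 = 0" "u t0 = 1"
    "\<And>t. 0 < t \<Longrightarrow> t < T \<Longrightarrow> 0 < u t" "\<And>t. 0 < t \<Longrightarrow> t < T \<Longrightarrow> t \<noteq> t0 \<Longrightarrow> u t < 1"
    "\<And>t. 0 \<le> t \<Longrightarrow> t \<le> t0 \<Longrightarrow> u' t = \<omega> * sqrt (1 - \<bar>u t\<bar> powr q)"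
    "\<And>t. t0 \<le> t \<Longrightarrow> t \<le> T \<Longrightarrow> u' t = - \<omega> * sqrt (1 - \<bar>u t\<bar> powr q)"
proof -
  obtain D :: "real \<Rightarrow> real" where D: "continuous_on UNIV D"
    "\<And>x. 0 \<le> x \<Longrightarrow> x \<le> 1 \<Longrightarrow> 0 < D x" "\<And>x. 0 \<le> x \<Longrightarrow> (1 - x) * D x = 1 - x powr (q / 2)"
    using powr_difference_quotient[of "q / 2"] q by auto
  \<comment> \<open>Chosen so that |cos x| R x = sqrt (1 - |sin x|^q). If the phase has derivative
    \<omega> R, then sin of the phase satisfies the desired first integral.\<close>
  define R where "R x = sqrt (D ((sin x)\<^sup>2))" for x
  have sin1: "0 \<le> (sin x)\<^sup>2" "(sin x)\<^sup>2 \<le> 1" for x :: real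
    using sin_cos_squared_add[of x] zero_le_power2[of "cos x"] by (simp, linarith)
  have Rpos: "0 < R x" for x using D(2)[OF sin1] by (simp add: R_def)
  have Rcont: "continuous_on A R" for A
    unfolding R_def by (intro continuous_intros continuous_on_compose2[OF D(1)]) auto
  have Rper: "R (x + pi) = R x" for x by (simp add: R_def)
  have "compact (D ` {0..1})"
    by (intro compact_continuous_image continuous_on_subset[OF D(1)]) auto
  then have "bounded (D ` {0..1})" by (rule compact_imp_bounded)
  then obtain C where "\<forall>y\<in>D ` {0..1}. norm y \<le> C" unfolding bounded_iff by blast
  then have C: "D x \<le> C" if "x \<in> {0..1}" for x using that by force
  have Cpos: "C > 0" using C[of 0] D(2)[of 0] by auto
  \<comment> \<open>The boundedness of D on [0,1] bounds R above, which is the positive lower bound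
    on 1 / R that a global phase demands.\<close>
  have mb: "1 / sqrt C \<le> 1 / R x" for x
    using C[of "(sin x)\<^sup>2"] sin1[of x] Rpos[of x] by (intro divide_left_mono) (auto simp: R_def)
  have mcont: "continuous_on UNIV (\<lambda>x. 1 / R x)"
    by (intro continuous_intros Rcont) (use Rpos in \<open>auto simp: less_imp_neq[symmetric]\<close>)
  obtain \<tau> \<Theta> :: "real \<Rightarrow> real" where \<tau>: "\<And>x. (\<tau> has_real_derivative 1 / R x) (at x)" "\<tau> 0 = 0"
    "\<And>x y. x < y \<Longrightarrow> \<tau> x < \<tau> y"
    and \<Theta>: "\<And>s. \<tau> (\<Theta> s) = s" "\<And>x. \<Theta> (\<tau> x) = x" "\<And>s. (\<Theta> has_real_derivative inverse (1 / R (\<Theta> s))) (at s)"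
    using strictly_increasing_reparametrization[OF mcont mb] Cpos by auto
  \<comment> \<open>This speed makes the phase \<theta> run from 0 to pi exactly while t runs from 0
    to T.\<close>
  define \<omega> where "\<omega> = \<tau> pi / T"
  have \<tau>pi: "\<tau> pi > 0" using \<tau>(3)[of 0 pi] \<tau>(2) by simp
  have \<omega>: "\<omega> > 0" using \<tau>pi T by (simp add: \<omega>_def)
  \<comment> \<open>R has period pi, so a shift of the phase by pi costs the fixed amount \<tau> pi.
    Hence \<theta> (t + T) = \<theta> t + pi, and sin and cos of the phase change sign after time
    T.\<close>
  have shift: "\<tau> (x + pi) = \<tau> x + \<tau> pi" for x
  proof -
    have "\<tau> (x + pi) - \<tau> x = \<tau> (0 + pi) - \<tau> 0"
    proof (rule DERIV_isconst_all[of "\<lambda>x. \<tau> (x + pi) - \<tau> x"], intro allI)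
      fix x
      show "((\<lambda>x. \<tau> (x + pi) - \<tau> x) has_real_derivative 0) (at x)"
        using DERIV_diff[OF DERIV_shift[THEN iffD1, OF \<tau>(1)[of "x + pi"]] \<tau>(1)[of x]] by (simp add: Rper)
    qed
    then show ?thesis using \<tau>(2) by simp
  qed
  define \<theta> where "\<theta> t = \<Theta> (\<omega> * t)" for t
  have \<tau>\<theta>: "\<tau> (\<theta> t) = \<omega> * t" for t by (simp add: \<theta>_def \<Theta>)
  have \<theta>eq: "\<theta> t = x" if "\<tau> x = \<omega> * t" for t x using that \<Theta>(2)[of x] by (simp add: \<theta>_def)
  have \<theta>mono: "\<theta> s < \<theta> t \<longleftrightarrow> s < t" for s t
  proof -
    have "\<tau> x < \<tau> y \<longleftrightarrow> x < y" for x y using \<tau>(3) by (metis linorder_less_linear order_less_asym)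
    then have "\<theta> s < \<theta> t \<longleftrightarrow> \<tau> (\<theta> s) < \<tau> (\<theta> t)" by simp
    also have "\<dots> \<longleftrightarrow> s < t" using \<omega> by (simp add: \<tau>\<theta>)
    finally show ?thesis .
  qed
  have \<theta>0: "\<theta> 0 = 0" by (rule \<theta>eq) (simp add: \<tau>)
  have \<theta>T: "\<theta> T = pi" by (rule \<theta>eq) (use T in \<open>simp add: \<omega>_def\<close>)
  have \<theta>shift: "\<theta> (t + T) = \<theta> t + pi" for t
    by (rule \<theta>eq) (use T in \<open>simp add: shift \<tau>\<theta> \<omega>_def distrib_left\<close>)
  have \<theta>D: "(\<theta> has_real_derivative \<omega> * R (\<theta> t)) (at t)" for t
  proof -
    have "((\<lambda>t. \<Theta> (\<omega> * t)) has_real_derivative inverse (1 / R (\<Theta> (\<omega> * t))) * \<omega>) (at t)"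
      by (rule DERIV_chain2[OF \<Theta>(3)]) (auto intro!: derivative_eq_intros)
    then show ?thesis by (simp add: \<theta>_def[abs_def] mult.commute)
  qed
  define t0 where "t0 = \<tau> (pi / 2) / \<omega>"
  have \<theta>t0: "\<theta> t0 = pi / 2" by (rule \<theta>eq) (use \<omega> in \<open>simp add: t0_def\<close>)
  have t0: "0 < t0" "t0 < T" using \<theta>mono[of 0 t0] \<theta>mono[of t0 T] by (auto simp: \<theta>0 \<theta>T \<theta>t0)
  define u u' where "u t = sin (\<theta> t)" and "u' t = \<omega> * cos (\<theta> t) * R (\<theta> t)" for t
  have uD: "(u has_real_derivative u' t) (at t)" for t
    unfolding u_def u'_def by (rule derivative_eq_intros \<theta>D refl)+ simp
  have \<theta>cont: "continuous_on A \<theta>" for A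
    using \<theta>D by (meson DERIV_isCont continuous_at_imp_continuous_on)
  have u'cont: "continuous_on UNIV u'"
    unfolding u'_def by (intro continuous_intros \<theta>cont continuous_on_compose2[OF Rcont]) auto
  have key: "\<bar>cos (\<theta> t)\<bar> * R (\<theta> t) = sqrt (1 - \<bar>u t\<bar> powr q)" for t
  proof -
    have "((u t)\<^sup>2) powr (q / 2) = (\<bar>u t\<bar> powr 2) powr (q / 2)" by simp
    also have "\<dots> = \<bar>u t\<bar> powr q" by (simp only: powr_powr) simp
    finally have "1 - \<bar>u t\<bar> powr q = (cos (\<theta> t))\<^sup>2 * D ((u t)\<^sup>2)"
      using D(3)[of "(u t)\<^sup>2"] by (simp add: u_def cos_squared_eq)
    then show ?thesis by (simp add: R_def u_def real_sqrt_mult)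
  qed
  have le_iff: "\<theta> s \<le> \<theta> t \<longleftrightarrow> s \<le> t" for s t using \<theta>mono[of t s] by (simp add: not_less[symmetric])
  have up: "u' t = \<omega> * sqrt (1 - \<bar>u t\<bar> powr q)" if "0 \<le> t" "t \<le> t0" for t
  proof -
    have "cos (\<theta> t) \<ge> 0"
      using that le_iff[of 0 t] le_iff[of t t0] by (intro cos_ge_zero) (auto simp: \<theta>0 \<theta>t0)
    then show ?thesis using key[of t] by (simp add: u'_def)
  qed
  have down: "u' t = - \<omega> * sqrt (1 - \<bar>u t\<bar> powr q)" if "t0 \<le> t" "t \<le> T" for t
  proof -
    have "cos (pi - \<theta> t) \<ge> 0"
      using that le_iff[of t0 t] le_iff[of t T] by (intro cos_ge_zero) (auto simp: \<theta>T \<theta>t0)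
    then have "cos (\<theta> t) \<le> 0" by simp
    then have "cos (\<theta> t) * R (\<theta> t) = - sqrt (1 - \<bar>u t\<bar> powr q)"
      using key[of t] by (simp add: abs_of_nonpos)
    then show ?thesis by (simp add: u'_def mult.assoc)
  qed
  have pos: "0 < u t" if "0 < t" "t < T" for t
    using that \<theta>mono[of 0 t] \<theta>mono[of t T] by (auto simp: u_def \<theta>0 \<theta>T intro: sin_gt_zero)
  have lt1: "u t < 1" if t: "0 < t" "t < T" "t \<noteq> t0" for t
  proof -
    have \<theta>t: "0 < \<theta> t" "\<theta> t < pi" using t \<theta>mono[of 0 t] \<theta>mono[of t T] by (auto simp: \<theta>0 \<theta>T)
    moreover have "\<theta> t \<noteq> pi / 2" using \<theta>mono[of t t0] \<theta>mono[of t0 t] t(3) \<theta>t0 by (metis linorder_neqE_linordered_idom order_less_irrefl)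
    ultimately have "cos (\<theta> t) \<noteq> cos (pi / 2)"
      using cos_inj_pi[of "\<theta> t" "pi / 2"] by (auto simp del: cos_pi_half)
    then have "(sin (\<theta> t))\<^sup>2 \<noteq> 1" by (simp add: sin_squared_eq)
    then show ?thesis using sin_le_one[of "\<theta> t"] unfolding u_def by (metis less_eq_real_def one_power2)
  qed
  show thesis
    by (rule that[of \<omega> t0 u u', OF \<omega> t0 uD u'cont _ _ _ _ pos lt1 up down])
      (auto simp: u_def u'_def \<theta>shift Rper \<theta>0 \<theta>t0)
qed

section \<open>The sharp inequality\<close>

text \<open>The hypothesis on T says that J0 is the critical point of (T - J) J^s. For the ratios x
  = J / J0 and y = (T - J) / (T - J0) it gives s (x - 1) + (y - 1) = 0, so ln z \<le> z - 1 applied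
  to x and y yields x^s y \<le> 1.\<close>

lemma weighted_power_maximum:
  fixes J0 J s T :: real
  assumes "0 < s" "0 < J0" "0 < J" and T: "T = J0 * (1 + 1 / s)"
  shows "(T - J) * J powr s \<le> (T - J0) * J0 powr s"
proof (cases "T - J \<le> 0")
  case True
  have "(T - J) * J powr s \<le> 0" using True by (simp add: mult_nonpos_nonneg)
  also have "0 \<le> (T - J0) * J0 powr s" using assms by (simp add: T algebra_simps)
  finally show ?thesis .
next
  case False
  define x y where "x = J / J0" and "y = 1 + s - s * x"
  have TJ0: "T - J0 = J0 / s" by (simp add: T algebra_simps)
  have TJ: "T - J = (T - J0) * y" using assms by (simp add: TJ0 x_def y_def T field_simps)
  have "0 < x" "0 < T - J0" using assms by (auto simp: x_def TJ0)
  moreover have "0 < (T - J0) * y" using TJ False by linarith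
  ultimately have pos: "0 < x" "0 < y" "0 < T - J0" by (auto simp: zero_less_mult_iff)
  have "s * ln x + ln y \<le> s * (x - 1) + (y - 1)"
    using ln_le_minus_one[of x] ln_le_minus_one[of y] pos \<open>0 < s\<close> by (intro add_mono mult_left_mono) auto
  also have "\<dots> = 0" by (simp add: y_def algebra_simps)
  finally have "exp (s * ln x + ln y) \<le> 1" by simp
  then have *: "x powr s * y \<le> 1" using pos by (simp add: exp_add powr_def)
  have "J powr s = x powr s * J0 powr s" using assms by (simp add: x_def powr_divide)
  then have "(T - J) * J powr s = ((T - J0) * J0 powr s) * (x powr s * y)" by (simp add: TJ)
  also have "\<dots> \<le> ((T - J0) * J0 powr s) * 1" using * pos by (intro mult_left_mono) auto
  finally show ?thesis by simp
qed

text \<open>Oddness makes an antiperiodic v into an antiperiodic H(v), which removes the unknown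
  boundary value from the estimate.\<close>

lemma odd_antiderivative_exists:
  fixes h :: "real \<Rightarrow> real"
  assumes h: "continuous_on UNIV h" and even: "\<And>x. h (- x) = h x"
  obtains H where "\<And>x. (H has_real_derivative h x) (at x)" "\<And>x. H (- x) = - H x"
proof -
  have "\<exists>F. \<forall>x :: real. -\<infinity> < ereal x \<longrightarrow> x < \<infinity> \<longrightarrow> (F has_vector_derivative h x) (at x)"
    by (rule einterval_antiderivative) (use h in \<open>auto simp: continuous_on_eq_continuous_at\<close>)
  then obtain F where F: "\<And>x. (F has_real_derivative h x) (at x)"
    by (auto simp: has_real_derivative_iff_has_vector_derivative)
  define H where "H x = (F x - F (- x)) / 2" for x
  have "(H has_real_derivative h x) (at x)" for x
  proof -
    have "((\<lambda>x. F (- x)) has_real_derivative h (- x) * (- 1)) (at x)"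
      by (rule DERIV_chain2[OF F]) (auto intro!: derivative_eq_intros)
    from DERIV_cdivide[OF DERIV_diff[OF F[of x] this], of 2] show ?thesis
      by (simp add: H_def[abs_def] even)
  qed
  moreover have "H (- x) = - H x" for x by (simp add: H_def field_simps)
  ultimately show thesis using that[of H] by blast
qed

lemma continuous_nonneg_integral_pos:
  fixes f :: "real \<Rightarrow> real"
  assumes f: "continuous_on {0..T} f" and T: "0 < T" and nonneg: "\<And>t. t \<in> {0..T} \<Longrightarrow> 0 \<le> f t"
    and t: "t \<in> {0..T}" "f t \<noteq> 0"
  shows "0 < (LINT t|lebesgue_on {0..T}. f t)"
proof -
  have "0 \<le> (LINT t|lebesgue_on {0..T}. f t)" by (rule integral_nonneg_AE) (auto intro!: AE_I2 nonneg)
  moreover have "(LINT t|lebesgue_on {0..T}. f t) \<noteq> 0"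
    using integralL_eq_0_iff[OF f T nonneg] t by blast
  ultimately show ?thesis by linarith
qed

lemma integral_interval_diff_const:
  fixes f :: "real \<Rightarrow> real"
  assumes T: "0 < T" and f: "integrable (lebesgue_on {0..T}) f"
  shows "(LINT t|lebesgue_on {0..T}. 1 - f t) = T - (LINT t|lebesgue_on {0..T}. f t)"
proof -
  have "(LINT t|lebesgue_on {0..T}. (1::real)) = T"
    using T lebesgue_integral_FTC[of 0 T "\<lambda>x. x" "\<lambda>_. 1"] by auto
  moreover have "integrable (lebesgue_on {0..T}) (\<lambda>t. 1 :: real)"
    by (intro continuous_imp_integrable_real continuous_intros)
  ultimately show ?thesis using f by simp
qed

text \<open>H(v) travels from H(v 0) to H(v t) and on to - H(v 0), so its variation is at least 2
  |H(v t)| whatever v 0 is. The weight h is left free so that the same bound serves p = 1.\<close>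

lemma sharp_inequality_normalized:
  fixes v g h H :: "real \<Rightarrow> real"
  assumes T: "0 < T" and v: "continuous_on {0..T} v" and g: "g \<in> Lp_space T 2"
    and vg: "\<And>s t. 0 \<le> s \<Longrightarrow> s \<le> t \<Longrightarrow> t \<le> T \<Longrightarrow> (LINT x|lebesgue_on {s..t}. g x) = v t - v s"
    and anti: "v 0 + v T = 0"
    and h: "continuous_on UNIV h" and H: "\<And>x. (H has_real_derivative h x) (at x)" "\<And>x. H (- x) = - H x"
    and t: "t \<in> {0..T}"
  shows "(2 * H (v t))\<^sup>2 \<le> (LINT t|lebesgue_on {0..T}. (h (v t))\<^sup>2) * (LINT t|lebesgue_on {0..T}. (g t)\<^sup>2)"
proof -
  have gi: "integrable (lebesgue_on {0..T}) g" using g by (rule Lp_space_2_integrable)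
  have hv: "continuous_on {0..T} (\<lambda>t. h (v t))" by (intro continuous_on_compose2[OF h v]) auto
  have bound: "\<bar>H (v b) - H (v a)\<bar> \<le> (LINT x|lebesgue_on {a..b}. \<bar>h (v x)\<bar> * \<bar>g x\<bar>)"
    if ab: "0 \<le> a" "a \<le> b" "b \<le> T" for a b
  proof (rule chain_rule_bound[where S = UNIV and h = h])
    show "continuous_on {a..b} v" using v by (rule continuous_on_subset) (use ab in auto)
    show "integrable (lebesgue_on {a..b}) g" using gi by (rule integrable_subinterval) (use ab in auto)
  qed (use ab H(1) h vg in auto)
  have int: "integrable (lebesgue_on {0..T}) (\<lambda>x. \<bar>h (v x)\<bar> * \<bar>g x\<bar>)"
    by (intro integrable_continuous_mult continuous_intros hv integrable_abs gi)
  have "v T = - v 0" using anti by linarith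
  then have "H (v T) = - H (v 0)" using H(2)[of "v 0"] by simp
  then have "\<bar>2 * H (v t)\<bar> \<le> \<bar>H (v t) - H (v 0)\<bar> + \<bar>H (v T) - H (v t)\<bar>" by linarith
  also have "\<dots> \<le> (LINT x|lebesgue_on {0..t}. \<bar>h (v x)\<bar> * \<bar>g x\<bar>) + (LINT x|lebesgue_on {t..T}. \<bar>h (v x)\<bar> * \<bar>g x\<bar>)"
    using bound[of 0 t] bound[of t T] t by auto
  also have "\<dots> = (LINT x|lebesgue_on {0..T}. \<bar>h (v x)\<bar> * \<bar>g x\<bar>)"
    using integral_combine[OF int, of t] t by simp
  also have "\<dots> = (LINT x|lebesgue_on {0..T}. \<bar>h (v x) * g x\<bar>)" by (simp add: abs_mult)
  finally have "(2 * H (v t))\<^sup>2 \<le> (LINT x|lebesgue_on {0..T}. \<bar>h (v x) * g x\<bar>)\<^sup>2"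
    by (intro iffD1[OF abs_le_square_iff]) simp
  also have "\<dots> \<le> (LINT t|lebesgue_on {0..T}. (h (v t))\<^sup>2) * (LINT t|lebesgue_on {0..T}. (g t)\<^sup>2)"
    by (rule Cauchy_Schwarz_integral(2))
      (use continuous_imp_Lp_space_2[OF hv] g in \<open>auto simp only: Lp_space_2_iff\<close>)
  finally show ?thesis .
qed

text \<open>The potential is treated separately for \<open>q = 2\<close> because \<open>0 powr 0 = 0\<close>.\<close>

lemma extremal_exists:
  fixes T q :: real
  assumes T: "0 < T" and q: "2 \<le> q"
  obtains u u' a :: "real \<Rightarrow> real" and \<kappa> :: real where
    "\<And>t. (u has_real_derivative u' t) (at t)" "continuous_on UNIV u'" "u \<in> X_ant_nonzero T"
    "0 < \<kappa>" "\<And>t. a t = (if q = 2 then \<kappa> else \<kappa> * \<bar>u t\<bar> powr (q - 2))" "continuous_on UNIV a"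
    "\<And>t. a (t + T) = a t" "antiperiodic_solution T a u"
    "0 < (LINT t|lebesgue_on {0..T}. \<bar>u t\<bar> powr q)"
    "(LINT t|lebesgue_on {0..T}. (u' t)\<^sup>2) = \<kappa> * (LINT t|lebesgue_on {0..T}. \<bar>u t\<bar> powr q)"
    "\<And>w. w \<in> X_ant_nonzero T \<Longrightarrow>
       (LINT t|lebesgue_on {0..T}. (u' t)\<^sup>2) * (LINT t|lebesgue_on {0..T}. \<bar>w t\<bar> powr q) powr (2 / q)
       \<le> (LINT t|lebesgue_on {0..T}. (weak_deriv T w t)\<^sup>2) * (LINT t|lebesgue_on {0..T}. \<bar>u t\<bar> powr q) powr (2 / q)"
proof -
  obtain u u' :: "real \<Rightarrow> real" and \<omega> t0 :: real where \<omega>: "0 < \<omega>" and t0: "0 < t0" "t0 < T"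
    and uD: "\<And>t. (u has_real_derivative u' t) (at t)" and u'c: "continuous_on UNIV u'"
    and per: "\<And>t. u (t + T) = - u t" "\<And>t. u' (t + T) = - u' t"
    and u0: "u 0 = 0" "u t0 = 1"
    and upos: "\<And>t. 0 < t \<Longrightarrow> t < T \<Longrightarrow> 0 < u t" and ult1: "\<And>t. 0 < t \<Longrightarrow> t < T \<Longrightarrow> t \<noteq> t0 \<Longrightarrow> u t < 1"
    and up: "\<And>t. 0 \<le> t \<Longrightarrow> t \<le> t0 \<Longrightarrow> u' t = \<omega> * sqrt (1 - \<bar>u t\<bar> powr q)"
    and down: "\<And>t. t0 \<le> t \<Longrightarrow> t \<le> T \<Longrightarrow> u' t = - \<omega> * sqrt (1 - \<bar>u t\<bar> powr q)"
    by (rule generalized_sine_exists[OF T q]) blast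
  have uT: "u T = 0" using per(1)[of 0] u0 by simp
  have u01: "0 \<le> u t" "u t \<le> 1" if "t \<in> {0..T}" for t
  proof -
    have "t = 0 \<or> t = T \<or> t = t0 \<or> (0 < t \<and> t < T \<and> t \<noteq> t0)" using that by auto
    then show "0 \<le> u t" "u t \<le> 1" using u0 uT upos[of t] ult1[of t] by (auto simp: less_imp_le)
  qed
  have uc: "continuous_on A u" for A
    using uD by (meson DERIV_isCont continuous_at_imp_continuous_on)
  have u'c': "continuous_on A u'" for A using u'c by (rule continuous_on_subset) simp
  \<comment> \<open>Differentiating u'^2 = \<omega>^2 (1 - u^q) and dividing by 2 u' gives u'' = -
    (\<omega>^2 q / 2) u^(q-1).\<close>
  define \<kappa> where "\<kappa> = \<omega>\<^sup>2 * q / 2"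
  have \<kappa>: "0 < \<kappa>" using \<omega> q by (simp add: \<kappa>_def)
  define f where "f t = - \<kappa> * (\<bar>u t\<bar> powr (q - 2) * u t)" for t
  \<comment> \<open>The sign of \<sigma> distinguishes the rising from the falling branch. Strict
    inequalities 0 < u < 1 are needed to differentiate the power and the square root, so the peak t0
    is left out.\<close>
  have gen: "(u' has_real_derivative f t) (at t)"
    if I: "open I" "t \<in> I" "\<And>s. s \<in> I \<Longrightarrow> u' s = \<sigma> * sqrt (1 - \<bar>u s\<bar> powr q)" "\<And>s. s \<in> I \<Longrightarrow> 0 < u s"
      and "u t < 1" "\<sigma>\<^sup>2 = \<omega>\<^sup>2" for I t \<sigma>
  proof -
    define S where "S = 1 - u t powr q"
    have ut: "0 < u t" using I by blast
    have "u t powr q < 1 powr q" using ut \<open>u t < 1\<close> q by (intro powr_less_mono2) auto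
    then have S: "S > 0" by (simp add: S_def)
    have "((\<lambda>s. u s powr q) has_real_derivative q * u t powr (q - 1) * u' t) (at t)"
      by (rule DERIV_chain2[OF has_real_derivative_powr[OF ut] uD])
    then have d: "((\<lambda>s. 1 - u s powr q) has_real_derivative 0 - q * u t powr (q - 1) * u' t) (at t)"
      by (intro DERIV_diff DERIV_const)
    have "(sqrt has_real_derivative inverse (sqrt S) / 2) (at (1 - u t powr q))"
      using DERIV_real_sqrt[OF S] by (simp add: S_def)
    from DERIV_chain2[where f = sqrt and g = "\<lambda>s. 1 - u s powr q", OF this d] have "((\<lambda>s. sqrt (1 - u s powr q)) has_real_derivative inverse (sqrt S) / 2 * (0 - q * u t powr (q - 1) * u' t)) (at t)"
      .
    then have "((\<lambda>s. \<sigma> * sqrt (1 - u s powr q)) has_real_derivative \<sigma> * (inverse (sqrt S) / 2 * (0 - q * u t powr (q - 1) * u' t))) (at t)"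
      by (rule DERIV_cmult)
    moreover have "\<sigma> * (inverse (sqrt S) / 2 * (0 - q * u t powr (q - 1) * u' t)) = f t"
    proof -
      have "u' t = \<sigma> * sqrt S" using I(2,3) ut by (simp add: S_def)
      then have \<sigma>: "inverse (sqrt S) * u' t = \<sigma>" using S by simp
      have "\<sigma> * (inverse (sqrt S) / 2 * (0 - q * u t powr (q - 1) * u' t))
          = - (\<sigma> * (inverse (sqrt S) * u' t) * q / 2) * u t powr (q - 1)"
        by (simp add: algebra_simps)
      also have "\<dots> = - (\<sigma>\<^sup>2 * q / 2) * u t powr (q - 1)" unfolding \<sigma> by (simp add: power2_eq_square)
      also have "\<dots> = f t"
      proof -
        have "u t powr (q - 1) = u t powr (q - 2) * u t powr 1" by (simp only: powr_add[symmetric]) simp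
        then show ?thesis using ut \<open>\<sigma>\<^sup>2 = \<omega>\<^sup>2\<close> by (simp add: f_def \<kappa>_def)
      qed
      finally show ?thesis .
    qed
    ultimately have "((\<lambda>s. \<sigma> * sqrt (1 - u s powr q)) has_real_derivative f t) (at t)" by simp
    then show ?thesis
      by (rule has_field_derivative_transform_within_open[OF _ I(1,2)]) (use I(3,4) in force)
  qed
  have u'D: "(u' has_real_derivative f t) (at t)" if t: "0 < t" "t < T" "t \<noteq> t0" for t
  proof (cases "t < t0")
    case True
    show ?thesis
      by (rule gen[of "{0<..<t0}" t \<omega>]) (use t True t0 up upos ult1[OF t] in auto)
  next
    case False
    show ?thesis
      by (rule gen[of "{t0<..<T}" t "- \<omega>"]) (use t False t0 down upos ult1[OF t] in auto)
  qed
  have fb: "\<bar>f t\<bar> \<le> \<kappa>" if "t \<in> {0..T}" for t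
  proof -
    have "\<bar>u t\<bar> powr (q - 2) \<le> 1 powr (q - 2)" using u01[OF that] q by (intro powr_mono2) auto
    then have "\<bar>u t\<bar> powr (q - 2) * \<bar>u t\<bar> \<le> 1 * 1" using u01[OF that] by (intro mult_mono) auto
    then have "\<kappa> * (\<bar>u t\<bar> powr (q - 2) * \<bar>u t\<bar>) \<le> \<kappa> * 1" using \<kappa> by (intro mult_left_mono) auto
    then show ?thesis using \<kappa> by (simp add: f_def abs_mult)
  qed
  \<comment> \<open>u' is continuous and differentiable in the interior except at t0, and its
    derivative is bounded by \<kappa>. The fundamental theorem with a finite exceptional set turns
    this into a Lipschitz bound across the peak, hence into absolute continuity.\<close>
  have lip: "\<bar>u' y - u' x\<bar> \<le> \<kappa> * (y - x)" if xy: "0 \<le> x" "x \<le> y" "y \<le> T" for x y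
  proof -
    have "(f has_integral (u' y - u' x)) {x..y}"
      by (rule fundamental_theorem_of_calculus_interior_strong[of "{t0}"])
        (use xy u'D u'c' in \<open>auto simp: has_real_derivative_iff_has_vector_derivative[symmetric]\<close>)
    from has_integral_bound_real[OF _ _ this, of \<kappa> "{}"] show ?thesis
      using fb xy \<kappa> by auto
  qed
  define a where "a t = (if q = 2 then \<kappa> else \<kappa> * \<bar>u t\<bar> powr (q - 2))" for t
  have au: "a t * u t = - f t" for t by (simp add: a_def f_def)
  have acont: "continuous_on A a" for A
  proof (cases "q = 2")
    case False
    then have "continuous_on A (\<lambda>t. \<kappa> * \<bar>u t\<bar> powr (q - 2))"
      using q by (intro continuous_intros continuous_on_powr' uc) auto
    then show ?thesis using False by (simp add: a_def[abs_def])
  qed (simp add: a_def[abs_def])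
  have sol: "antiperiodic_solution T a u"
    unfolding antiperiodic_solution_def
  proof (intro exI[of _ u'] conjI ballI)
    show "(u has_real_derivative u' t) (at t within {0..T})" for t
      using uD by (rule has_field_derivative_at_within)
    show "abs_continuous_on_interval 0 T u'" by (rule lipschitz_imp_abs_continuous[OF lip])
    have "AE t in lebesgue_on {0..T}. t \<notin> {0, t0, T}"
      by (rule AE_not_in) (use t0 T in auto)
    then show "AE t in lebesgue_on {0..T}. \<exists>u''. (u' has_real_derivative u'') (at t within {0..T}) \<and> u'' + a t * u t = 0"
      using AE_space[of "lebesgue_on {0..T}"]
    proof eventually_elim
      case (elim t)
      then have "0 < t" "t < T" "t \<noteq> t0" by auto
      then have "(u' has_real_derivative f t) (at t within {0..T})"
        by (rule has_field_derivative_at_within[OF u'D])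
      then show ?case by (intro exI[of _ "f t"]) (simp add: au)
    qed
    show "u 0 + u T = 0" "u' 0 + u' T = 0" using per[of 0] by simp_all
  qed
  note H1 = C1_in_H1[OF T has_field_derivative_at_within[OF uD] u'c']
  have X: "u \<in> X_ant_nonzero T"
    using H1(1) u0 uT t0 by (auto simp: X_ant_nonzero_def X_ant_def intro!: bexI[of _ t0])
  define J0 where "J0 = (LINT t|lebesgue_on {0..T}. \<bar>u t\<bar> powr q)"
  define E where "E = (LINT t|lebesgue_on {0..T}. (u' t)\<^sup>2)"
  have powc: "continuous_on A (\<lambda>t. \<bar>w t\<bar> powr q)" if "continuous_on A w" for w :: "real \<Rightarrow> real" and A
    using q that by (intro continuous_on_abs_powr) auto
  have J0: "0 < J0" unfolding J0_def
    by (rule continuous_nonneg_integral_pos[OF powc[OF uc] T _, of t0]) (use t0 u0 in auto)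
  have E1: "E = \<kappa> * J0"
  proof -
    \<comment> \<open>The energy identity supplies some derivative v' of u. It and u' both represent
      the weak derivative of u, so their squares have the same integral.\<close>
    obtain v' where "\<And>t. t \<in> {0..T} \<Longrightarrow> (u has_real_derivative v' t) (at t within {0..T})" "continuous_on {0..T} v'"
      and v': "(LINT t|lebesgue_on {0..T}. (v' t)\<^sup>2) = (LINT t|lebesgue_on {0..T}. a t * (u t)\<^sup>2)"
      using antiperiodic_solution_energy[OF T sol continuous_imp_integrable_real[OF acont]] by blast
    then have "(LINT t|lebesgue_on {0..T}. (v' t)\<^sup>2) = E"
      using C1_in_H1(2)[OF T, of u v'] H1(2) by (simp add: E_def)
    moreover have "a t * (u t)\<^sup>2 = \<kappa> * \<bar>u t\<bar> powr q" for t
    proof -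
      have "\<bar>u t\<bar> powr q = \<bar>u t\<bar> powr (q - 2) * \<bar>u t\<bar> powr 2" by (simp only: powr_add[symmetric]) simp
      then show ?thesis by (auto simp: a_def)
    qed
    ultimately show ?thesis using v' by (simp add: J0_def)
  qed
  \<comment> \<open>With this weight |u'| = \<omega> h(u), so Cauchy-Schwarz is an equality for
    u.\<close>
  define h where "h x = sqrt (1 - \<bar>x\<bar> powr q)" for x :: real
  have hc: "continuous_on UNIV h" unfolding h_def by (intro continuous_intros powc)
  obtain H where H: "\<And>x. (H has_real_derivative h x) (at x)" "\<And>x. H (- x) = - H x"
    using odd_antiderivative_exists[OF hc] by (auto simp: h_def)
  have H0: "H 0 = 0" using H(2)[of 0] by simp
  have h2: "(h x)\<^sup>2 = 1 - \<bar>x\<bar> powr q" if "\<bar>x\<bar> \<le> 1" for x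
  proof -
    have "\<bar>x\<bar> powr q \<le> 1 powr q" using that q by (intro powr_mono2) auto
    then show ?thesis by (simp add: h_def)
  qed
  have hu2: "(h (u t))\<^sup>2 = 1 - \<bar>u t\<bar> powr q" if "t \<in> {0..T}" for t
    using u01[OF that] by (intro h2) auto
  have huc: "continuous_on A (\<lambda>t. (h (u t))\<^sup>2)" for A
    by (intro continuous_intros continuous_on_compose2[OF hc uc]) auto
  have HuD: "((\<lambda>t. H (u t)) has_real_derivative h (u t) * u' t) (at t)" for t
    by (rule DERIV_chain2[OF H(1) uD])
  have u'h: "u' t = (if t \<le> t0 then \<omega> * h (u t) else - \<omega> * h (u t))" if "t \<in> {0..T}" for t
    using that up[of t] down[of t] by (auto simp: h_def)
  have I1: "(LINT t|lebesgue_on {0..t0}. \<omega> * (h (u t))\<^sup>2) = H (u t0) - H (u 0)"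
  proof (rule lebesgue_integral_FTC)
    fix t assume "t \<in> {0..t0}"
    then have "h (u t) * u' t = \<omega> * (h (u t))\<^sup>2" using up[of t] by (simp add: h_def[symmetric] power2_eq_square)
    then show "((\<lambda>t. H (u t)) has_real_derivative \<omega> * (h (u t))\<^sup>2) (at t within {0..t0})"
      using has_field_derivative_at_within[OF HuD[of t]] by simp
  qed (use t0 in \<open>auto intro!: continuous_intros huc\<close>)
  have I2: "(LINT t|lebesgue_on {t0..T}. \<omega> * (h (u t))\<^sup>2) = - H (u T) - - H (u t0)"
  proof (rule lebesgue_integral_FTC)
    fix t assume "t \<in> {t0..T}"
    then have "h (u t) * u' t = - (\<omega> * (h (u t))\<^sup>2)" using down[of t] by (simp add: h_def[symmetric] power2_eq_square)
    then show "((\<lambda>t. - H (u t)) has_real_derivative \<omega> * (h (u t))\<^sup>2) (at t within {t0..T})"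
      using DERIV_minus[OF has_field_derivative_at_within[OF HuD[of t]]] by simp
  qed (use t0 in \<open>auto intro!: continuous_intros huc\<close>)
  have hint: "integrable (lebesgue_on {0..T}) (\<lambda>t. \<omega> * (h (u t))\<^sup>2)"
    by (intro continuous_imp_integrable_real continuous_intros huc)
  have uq: "integrable (lebesgue_on {0..T}) (\<lambda>t. \<bar>u t\<bar> powr q)"
    by (intro continuous_imp_integrable_real powc uc)
  have hu_int: "(LINT t|lebesgue_on {0..T}. (h (u t))\<^sup>2) = T - J0"
    unfolding J0_def integral_interval_diff_const[OF T uq, symmetric]
    by (rule Bochner_Integration.integral_cong) (use hu2 in auto)
  \<comment> \<open>H(u) climbs from 0 to H 1 up to t0 and descends back to 0, in both cases at the
    rate \<omega> (h(u))^2. The variation bound is therefore an equality for u as well.\<close>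
  have c: "2 * H 1 = \<omega> * (T - J0)"
    using integral_combine[OF hint, of t0] I1 I2 t0 hu_int u0 uT H0 by simp
  have E2: "E = \<omega>\<^sup>2 * (T - J0)"
  proof -
    have "E = (LINT t|lebesgue_on {0..T}. \<omega>\<^sup>2 * (h (u t))\<^sup>2)"
      unfolding E_def by (rule Bochner_Integration.integral_cong) (use u'h in \<open>auto simp: power_mult_distrib\<close>)
    then show ?thesis using hu_int by simp
  qed
  have "\<omega>\<^sup>2 * (T - J0) = \<omega>\<^sup>2 * (q / 2 * J0)" using E1 E2 by (simp add: \<kappa>_def)
  then have TJ0: "T - J0 = q / 2 * J0" using \<omega> by simp
  \<comment> \<open>Comparing the two formulas for E shows that J0 satisfies the criticality
    condition of \<open>weighted_power_maximum\<close> with s = 2/q.\<close>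
  then have TJ: "T = J0 * (1 + 1 / (2 / q))" by (simp add: algebra_simps)
  have TJpos: "T - J0 > 0" unfolding TJ0 using J0 q by simp
  have sharp: "E * (LINT t|lebesgue_on {0..T}. \<bar>w t\<bar> powr q) powr (2 / q)
       \<le> (LINT t|lebesgue_on {0..T}. (weak_deriv T w t)\<^sup>2) * J0 powr (2 / q)"
    if w: "w \<in> X_ant_nonzero T" for w
  proof -
    define g where "g = weak_deriv T w"
    define Ew where "Ew = (LINT t|lebesgue_on {0..T}. (g t)\<^sup>2)"
    have wH: "w \<in> H1 T" and w0: "w 0 + w T = 0" and wn: "\<exists>t\<in>{0..T}. w t \<noteq> 0"
      using w by (auto simp: X_ant_nonzero_def X_ant_def)
    have wc: "continuous_on {0..T} w" using wH by (simp add: H1_def)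
    have gL: "g \<in> Lp_space T 2" unfolding g_def by (rule H1_weak_deriv[OF wH])
    obtain tM where tM: "tM \<in> {0..T}" "\<And>t. t \<in> {0..T} \<Longrightarrow> \<bar>w t\<bar> \<le> \<bar>w tM\<bar>"
    proof -
      have "continuous_on {0..T} (\<lambda>t. \<bar>w t\<bar>)" by (intro continuous_intros wc)
      then obtain x where "x \<in> {0..T}" "\<forall>y\<in>{0..T}. \<bar>w y\<bar> \<le> \<bar>w x\<bar>"
        using continuous_attains_sup[of "{0..T}" "\<lambda>t. \<bar>w t\<bar>"] T by auto
      then show thesis using that by blast
    qed
    define M where "M = \<bar>w tM\<bar>"
    have M: "M > 0" using wn tM(2) unfolding M_def by force
    \<comment> \<open>Scaling to maximum 1 keeps the values in [-1,1], where (h x)^2 is 1 - |x|^q.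
      The factor M is restored at the end, since both sides of the inequality scale like
      M^2.\<close>
    define v where "v t = w t / M" for t
    have vc: "continuous_on {0..T} v" unfolding v_def using M by (intro continuous_intros wc) auto
    have v1: "\<bar>v t\<bar> \<le> 1" if "t \<in> {0..T}" for t using tM(2)[OF that] M by (simp add: v_def M_def)
    have vtM: "v tM = 1 \<or> v tM = - 1" using M by (auto simp: v_def M_def abs_if)
    have "(2 * H (v tM))\<^sup>2 \<le> (LINT t|lebesgue_on {0..T}. (h (v t))\<^sup>2) * (LINT t|lebesgue_on {0..T}. (g t / M)\<^sup>2)"
    proof (rule sharp_inequality_normalized[OF T vc _ _ _ hc H tM(1)])
      show "(\<lambda>t. g t / M) \<in> Lp_space T 2" using gL unfolding Lp_space_2_iff
        by (auto simp: power_divide intro!: borel_measurable_divide)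
      show "(LINT x|lebesgue_on {s..t}. g x / M) = v t - v s" if "0 \<le> s" "s \<le> t" "t \<le> T" for s t
        using H1_weak_deriv_integral[OF T wH that] by (simp add: g_def v_def diff_divide_distrib)
      show "v 0 + v T = 0" using w0 by (simp add: v_def add_divide_distrib[symmetric])
    qed
    also have "(LINT t|lebesgue_on {0..T}. (g t / M)\<^sup>2) = Ew / M\<^sup>2" by (simp add: Ew_def power_divide)
    also have "(2 * H (v tM))\<^sup>2 = (2 * H 1)\<^sup>2" using vtM H(2)[of 1] by auto
    \<comment> \<open>(2 H 1)^2 is \<omega>^2 (T - J0)^2; absorbing \<omega>^2 and one factor T - J0
      into E gives a left side of the same shape as the right one.\<close>
    also have "\<dots> = E * (T - J0)" by (simp add: c E2 power2_eq_square)
    finally have ineq: "E * (T - J0) \<le> (LINT t|lebesgue_on {0..T}. (h (v t))\<^sup>2) * (Ew / M\<^sup>2)" .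
    define J where "J = (LINT t|lebesgue_on {0..T}. \<bar>v t\<bar> powr q)"
    have vq: "integrable (lebesgue_on {0..T}) (\<lambda>t. \<bar>v t\<bar> powr q)"
      by (intro continuous_imp_integrable_real powc vc)
    have "(LINT t|lebesgue_on {0..T}. (h (v t))\<^sup>2) = T - J"
      unfolding J_def integral_interval_diff_const[OF T vq, symmetric]
      by (rule Bochner_Integration.integral_cong) (use h2 v1 in auto)
    with ineq have ineq: "E * (T - J0) \<le> (T - J) * (Ew / M\<^sup>2)" by simp
    have J: "J > 0" unfolding J_def
      by (rule continuous_nonneg_integral_pos[OF powc[OF vc] T _ tM(1)]) (use vtM in auto)
    have Ew: "0 \<le> Ew" by (simp add: Ew_def)
    \<comment> \<open>Multiplication by J^(2/q) produces the product that is largest at J0;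
      afterwards the common factor T - J0 cancels.\<close>
    have "E * J powr (2 / q) * (T - J0) \<le> (T - J) * (Ew / M\<^sup>2) * J powr (2 / q)"
      using mult_right_mono[OF ineq, of "J powr (2 / q)"] by (simp add: mult_ac)
    also have "\<dots> = ((T - J) * J powr (2 / q)) * (Ew / M\<^sup>2)" by simp
    also have "\<dots> \<le> ((T - J0) * J0 powr (2 / q)) * (Ew / M\<^sup>2)"
      by (intro mult_right_mono weighted_power_maximum[OF _ J0 J TJ]) (use q Ew in auto)
    finally have "(E * J powr (2 / q)) * (T - J0) \<le> (J0 powr (2 / q) * (Ew / M\<^sup>2)) * (T - J0)"
      by (simp only: mult_ac)
    then have "E * J powr (2 / q) \<le> J0 powr (2 / q) * (Ew / M\<^sup>2)"
      using TJpos by (rule mult_right_le_imp_le)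
    then have fin: "E * (J powr (2 / q) * M\<^sup>2) \<le> Ew * J0 powr (2 / q)"
      using M by (simp add: field_simps)
    have "\<bar>w t\<bar> powr q = M powr q * \<bar>v t\<bar> powr q" for t
      using M by (simp add: v_def powr_divide)
    then have "(LINT t|lebesgue_on {0..T}. \<bar>w t\<bar> powr q) = M powr q * J" by (simp add: J_def)
    then have "(LINT t|lebesgue_on {0..T}. \<bar>w t\<bar> powr q) powr (2 / q) = M powr 2 * J powr (2 / q)"
      using M J q by (simp add: powr_mult powr_powr)
    then show ?thesis using fin M by (simp add: Ew_def g_def mult_ac)
  qed
  show thesis
  proof (rule that[of u u' \<kappa> a])
    show "a (t + T) = a t" for t by (simp add: a_def per)
  qed (use uD u'c X \<kappa> acont sol J0 E1 sharp in \<open>auto simp: a_def J0_def E_def\<close>)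
qed

section \<open>The Lyapunov constants\<close>

text \<open>The exponents correspond by \<open>q = 2p/(p-1)\<close>, with \<open>q = 2\<close> for \<open>p = \<infinity>\<close>.\<close>

lemma I_ant_denominator_powr:
  assumes q: "2 \<le> q" and p: "p = (if q = 2 then \<infinity> else ereal (q / (q - 2)))"
  shows "I_ant_denominator T p v = (LINT t|lebesgue_on {0..T}. \<bar>v t\<bar> powr q) powr (2 / q)"
proof (cases "q = 2")
  case True
  then show ?thesis using p by (simp add: I_ant_denominator_def one_ereal_def)
next
  case False
  define r where "r = q / (q - 2)"
  have r: "2 * r / (r - 1) = q" "(r - 1) / r = 2 / q" "r \<noteq> 1"
    using q False by (auto simp: r_def divide_simps)
  have "p = ereal r" using p False by (simp add: r_def)
  then show ?thesis using r by (simp add: I_ant_denominator_def Let_def one_ereal_def)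
qed

lemma X_ant_pos_integral:
  assumes T: "0 < T" and q: "0 < q" and w: "w \<in> X_ant_nonzero T"
  shows "0 < (LINT t|lebesgue_on {0..T}. \<bar>w t\<bar> powr q)"
proof -
  have wc: "continuous_on {0..T} w" and "\<exists>t\<in>{0..T}. w t \<noteq> 0"
    using w by (auto simp: X_ant_nonzero_def X_ant_def H1_def)
  then obtain t where t: "t \<in> {0..T}" "w t \<noteq> 0" by blast
  show ?thesis
    by (rule continuous_nonneg_integral_pos[OF continuous_on_abs_powr[OF wc q] T _ t(1)]) (use t in auto)
qed

lemma continuous_Lp_space:
  assumes T: "0 < T" and p: "1 \<le> p" and a: "continuous_on {0..T} a"
  shows "a \<in> Lp_space T p"
proof (cases "p = \<infinity>")
  case True
  obtain B where "\<And>t. t \<in> {0..T} \<Longrightarrow> \<bar>a t\<bar> \<le> B" using continuous_on_interval_bounded[OF a] by blast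
  then show ?thesis using continuous_L_infinity(1)[OF T a] True by blast
next
  case False
  then have "0 < real_of_ereal p" using p by (cases p) auto
  then have "continuous_on {0..T} (\<lambda>t. \<bar>a t\<bar> powr real_of_ereal p)"
    by (intro continuous_on_abs_powr a)
  then show ?thesis
    using False continuous_imp_integrable_real continuous_imp_measurable_on_sets_lebesgue[OF a]
    by (auto simp: Lp_space_def)
qed

text \<open>For finite p = q/(q-2), (q - 2) p = q, so the p-th power of a = \<kappa> |u|^(q-2) is a
  multiple of |u|^q and its norm is \<kappa> J0^(1 - 2/q). This is also I_p(u), because the energy
  of u is \<kappa> J0. For q = 2 the potential is the constant \<kappa>.\<close>

lemma minimizer_exists:
  fixes T q :: real
  assumes T: "0 < T" and q: "2 \<le> q" and p: "p = (if q = 2 then \<infinity> else ereal (q / (q - 2)))"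
  obtains u a where "u \<in> X_ant_nonzero T" "\<And>w. w \<in> X_ant_nonzero T \<Longrightarrow> I_ant T p u \<le> I_ant T p w"
    "a \<in> Lambda_ant T" "continuous_on UNIV a" "\<And>t. 0 \<le> a t" "Lp_norm T p a \<le> I_ant T p u"
proof -
  obtain u u' a :: "real \<Rightarrow> real" and \<kappa> :: real where
    uD: "\<And>t. (u has_real_derivative u' t) (at t)" and u'c: "continuous_on UNIV u'" and X: "u \<in> X_ant_nonzero T"
    and \<kappa>: "0 < \<kappa>" and a: "\<And>t. a t = (if q = 2 then \<kappa> else \<kappa> * \<bar>u t\<bar> powr (q - 2))" and ac: "continuous_on UNIV a"
    and per: "\<And>t. a (t + T) = a t" and sol: "antiperiodic_solution T a u"
    and J: "0 < (LINT t|lebesgue_on {0..T}. \<bar>u t\<bar> powr q)"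
    and E: "(LINT t|lebesgue_on {0..T}. (u' t)\<^sup>2) = \<kappa> * (LINT t|lebesgue_on {0..T}. \<bar>u t\<bar> powr q)"
    and sharp: "\<And>w. w \<in> X_ant_nonzero T \<Longrightarrow>
       (LINT t|lebesgue_on {0..T}. (u' t)\<^sup>2) * (LINT t|lebesgue_on {0..T}. \<bar>w t\<bar> powr q) powr (2 / q)
       \<le> (LINT t|lebesgue_on {0..T}. (weak_deriv T w t)\<^sup>2) * (LINT t|lebesgue_on {0..T}. \<bar>u t\<bar> powr q) powr (2 / q)"
    by (rule extremal_exists[OF T q]) blast
  define J0 where "J0 = (LINT t|lebesgue_on {0..T}. \<bar>u t\<bar> powr q)"
  have J0: "0 < J0" using J by (simp add: J0_def)
  have Eu: "(LINT t|lebesgue_on {0..T}. (weak_deriv T u t)\<^sup>2) = (LINT t|lebesgue_on {0..T}. (u' t)\<^sup>2)"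
    by (rule C1_in_H1(2)[OF T has_field_derivative_at_within[OF uD] continuous_on_subset[OF u'c]]) simp
  have Iu: "I_ant T p u = \<kappa> * J0 / J0 powr (2 / q)"
    unfolding I_ant_eq I_ant_denominator_powr[OF q p] Eu E J0_def ..
  have min: "I_ant T p u \<le> I_ant T p w" if w: "w \<in> X_ant_nonzero T" for w
  proof -
    have "0 < (LINT t|lebesgue_on {0..T}. \<bar>w t\<bar> powr q)" by (rule X_ant_pos_integral[OF T _ w]) (use q in simp)
    then show ?thesis
      unfolding I_ant_eq I_ant_denominator_powr[OF q p] Eu
      using sharp[OF w] J by (simp add: divide_simps mult_ac)
  qed
  have aT: "continuous_on {0..T} a" using ac by (rule continuous_on_subset) simp
  have "a \<in> Lp_space T 1" by (rule continuous_Lp_space[OF T _ aT]) simp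
  then have aL: "a \<in> Lambda_ant T"
    using per sol X by (auto simp: Lambda_ant_def L_periodic_def X_ant_nonzero_def)
  have a0: "0 \<le> a t" for t using \<kappa> by (simp add: a)
  have norm: "Lp_norm T p a \<le> I_ant T p u"
  proof (cases "q = 2")
    case True
    then have "Lp_norm T p a \<le> \<kappa>"
      using continuous_L_infinity(2)[OF T aT, of \<kappa>] \<kappa> p by (simp add: a)
    then show ?thesis using Iu J0 True by simp
  next
    case False
    define r where "r = q / (q - 2)"
    have r: "(q - 2) * r = q" "1 / r = 1 - 2 / q" "r > 0" using q False by (auto simp: r_def divide_simps)
    have "\<bar>a t\<bar> powr r = \<kappa> powr r * \<bar>u t\<bar> powr q" for t
      using False \<kappa> r(1) by (simp add: a abs_mult powr_mult powr_powr)
    then have "Lp_norm T p a = (\<kappa> powr r * J0) powr (1 / r)"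
      using p False by (simp add: Lp_norm_def r_def[symmetric] J0_def)
    also have "\<dots> = \<kappa> * J0 powr (1 / r)" using \<kappa> J0 r(3) by (simp add: powr_mult powr_powr)
    also have "\<dots> = \<kappa> * J0 / J0 powr (2 / q)" using J0 by (simp add: r(2) powr_diff)
    finally show ?thesis using Iu by simp
  qed
  show thesis by (rule that[OF X min aL ac a0 norm])
qed

section \<open>Transfer to the infimum over potentials\<close>

lemma beta_ant_ge:
  assumes T: "0 < T" and p: "1 \<le> p" and min: "\<And>w. w \<in> X_ant_nonzero T \<Longrightarrow> c \<le> I_ant T p w"
  shows "ereal c \<le> beta_ant T p"
  unfolding beta_ant_def
proof (rule INF_greatest)
  fix a assume "a \<in> Lambda_ant T \<inter> Lp_space T p"
  then obtain u where "u \<in> X_ant_nonzero T" "I_ant T p u \<le> Lp_norm T p (\<lambda>t. max (a t) 0)"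
    using Lambda_ant_norm_ge[OF T p] by blast
  then show "ereal c \<le> ereal (Lp_norm T p (\<lambda>t. max (a t) 0))" using min[of u] by simp
qed

lemma beta_ant_le:
  assumes T: "0 < T" and p: "1 \<le> p" and a: "a \<in> Lambda_ant T" "continuous_on UNIV a" "\<And>t. 0 \<le> a t"
    and le: "Lp_norm T p a \<le> c"
  shows "beta_ant T p \<le> ereal c"
proof -
  have aT: "continuous_on {0..T} a" using a(2) by (rule continuous_on_subset) simp
  have "beta_ant T p \<le> ereal (Lp_norm T p (\<lambda>t. max (a t) 0))"
    unfolding beta_ant_def by (rule INF_lower) (use a(1) continuous_Lp_space[OF T p aT] in simp)
  also have "(\<lambda>t. max (a t) 0) = a" using a(3) by (simp add: fun_eq_iff max_absorb1)
  also have "ereal (Lp_norm T p a) \<le> ereal c" using le by simp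
  finally show ?thesis .
qed

section \<open>The exponent p = 1\<close>

lemma I_ant_1_ge:
  assumes T: "0 < T" and w: "w \<in> X_ant_nonzero T"
  shows "4 / T \<le> I_ant T 1 w"
proof -
  define g where "g = weak_deriv T w"
  define E where "E = (LINT t|lebesgue_on {0..T}. (g t)\<^sup>2)"
  have wH: "w \<in> H1 T" and w0: "w 0 + w T = 0" and wn: "\<exists>t\<in>{0..T}. w t \<noteq> 0"
    using w by (auto simp: X_ant_nonzero_def X_ant_def)
  have wc: "continuous_on {0..T} w" using wH by (simp add: H1_def)
  have gL: "g \<in> Lp_space T 2" unfolding g_def by (rule H1_weak_deriv[OF wH])
  \<comment> \<open>With h = 1 and H the identity, the first factor of the general inequality is T,
    and the bound holds at every point.\<close>
  have E: "(2 * w t)\<^sup>2 \<le> T * E" if t: "t \<in> {0..T}" for t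
  proof -
    have "(2 * w t)\<^sup>2 \<le> (LINT t|lebesgue_on {0..T}. (1::real)\<^sup>2) * (LINT t|lebesgue_on {0..T}. (g t)\<^sup>2)"
      by (rule sharp_inequality_normalized[where H = "\<lambda>x. x" and h = "\<lambda>_. 1", OF T wc gL])
        (use H1_weak_deriv_integral[OF T wH] w0 t in \<open>auto simp: g_def\<close>)
    moreover have "(LINT t|lebesgue_on {0..T}. (1::real)\<^sup>2) = T"
      using T lebesgue_integral_FTC[of 0 T "\<lambda>x. x" "\<lambda>_. 1"] by auto
    ultimately show ?thesis by (simp add: E_def)
  qed
  have bound: "\<bar>w t\<bar> \<le> sqrt (T * E / 4)" if "t \<in> {0..T}" for t
    using E[OF that] by (intro real_le_rsqrt) (simp add: power_mult_distrib)
  define N where "N = Lp_norm T \<infinity> w"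
  have wL: "w \<in> Lp_space T \<infinity>" and N: "N \<le> sqrt (T * E / 4)"
    using continuous_L_infinity[OF T wc bound] by (auto simp: N_def)
  have ae: "AE t in lebesgue_on {0..T}. \<bar>w t\<bar> \<le> N" unfolding N_def by (rule L_infinity_norm(1)[OF T wL])
  \<comment> \<open>The essential supremum could a priori miss the point where w is nonzero;
    continuity turns the bound almost everywhere into one at that point.\<close>
  have "N > 0"
  proof -
    obtain t where t: "t \<in> {0..T}" "w t \<noteq> 0" using wn by blast
    have "\<bar>w t\<bar> \<le> N" by (rule continuous_AE_le_imp_le[OF T _ ae t(1)]) (intro continuous_intros wc)
    then show ?thesis using t(2) by linarith
  qed
  have "0 \<le> T * E / 4" using T by (simp add: E_def)
  then have "N\<^sup>2 \<le> T * E / 4" using N \<open>N > 0\<close> by (metis less_imp_le power_mono real_sqrt_pow2)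
  then have "4 / T \<le> E / N\<^sup>2" using T \<open>N > 0\<close> by (simp add: field_simps)
  then show ?thesis by (simp add: I_ant_eq I_ant_denominator_def E_def g_def N_def)
qed

lemma affine_function_X_ant:
  assumes T: "0 < T"
  defines "v \<equiv> \<lambda>t. 1 - 2 * t / T"
  shows "v \<in> X_ant_nonzero T" "(LINT t|lebesgue_on {0..T}. (weak_deriv T v t)\<^sup>2) = 4 / T"
proof -
  have D: "(v has_real_derivative - 2 / T) (at t within {0..T})" for t
    unfolding v_def using T by (auto intro!: derivative_eq_intros)
  have c: "continuous_on {0..T} (\<lambda>_. - 2 / T)" by simp
  note H1 = C1_in_H1[OF T D c]
  show "v \<in> X_ant_nonzero T"
    using H1(1) T by (auto simp: X_ant_nonzero_def X_ant_def v_def intro!: bexI[of _ 0])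
  have "(LINT t|lebesgue_on {0..T}. (- 2 / T)\<^sup>2) = (- 2 / T)\<^sup>2 * T - (- 2 / T)\<^sup>2 * 0"
    by (rule lebesgue_integral_FTC) (use T in \<open>auto intro!: derivative_eq_intros\<close>)
  then show "(LINT t|lebesgue_on {0..T}. (weak_deriv T v t)\<^sup>2) = 4 / T"
    using H1(2) T by (simp add: power2_eq_square)
qed

lemma I_ant_1_affine:
  assumes T: "0 < T"
  shows "I_ant T 1 (\<lambda>t. 1 - 2 * t / T) = 4 / T"
proof -
  define v where "v = (\<lambda>t. 1 - 2 * t / T)"
  have c: "continuous_on {0..T} v" unfolding v_def using T by (intro continuous_intros) auto
  have b: "\<bar>v t\<bar> \<le> 1" if "t \<in> {0..T}" for t using that T by (auto simp: v_def abs_le_iff field_simps)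
  have vL: "v \<in> Lp_space T \<infinity>" "Lp_norm T \<infinity> v \<le> 1" using continuous_L_infinity[OF T c b] by auto
  have "\<bar>v 0\<bar> \<le> Lp_norm T \<infinity> v"
    by (rule continuous_AE_le_imp_le[OF T _ L_infinity_norm(1)[OF T vL(1)]])
      (use T in \<open>auto intro!: continuous_intros c\<close>)
  then have "Lp_norm T \<infinity> v = 1" using vL(2) by (simp add: v_def)
  then show ?thesis
    using affine_function_X_ant(2)[OF T] by (simp add: I_ant_eq I_ant_denominator_def v_def)
qed

text \<open>Only the half where 1 - 2t/T is positive is integrated. Dropping the symmetric other
  half loses a factor 2, whose power 2/q tends to 1 as q grows, so the crude bound is good enough in
  the limit.\<close>

lemma affine_power_integral:
  fixes T q :: real
  assumes T: "0 < T" and q: "2 \<le> q"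
  shows "(LINT t|lebesgue_on {0..T}. \<bar>1 - 2 * t / T\<bar> powr q) \<ge> T / (2 * (q + 1))"
proof -
  have c: "continuous_on A (\<lambda>t. \<bar>1 - 2 * t / T\<bar> powr q)" for A
    using T q by (intro continuous_on_abs_powr continuous_intros) auto
  define F where "F t = - (T / (2 * (q + 1))) * (1 - 2 * t / T) powr (q + 1)" for t
  have "((\<lambda>t. \<bar>1 - 2 * t / T\<bar> powr q) has_integral (F (T/2) - F 0)) {0..T/2}"
  proof (rule fundamental_theorem_of_calculus_interior)
    show "continuous_on {0..T/2} F"
      unfolding F_def using T q by (intro continuous_intros continuous_on_powr') (auto simp: field_simps)
    fix t assume t: "t \<in> {0<..<T/2}"
    then have pos: "0 < 1 - 2 * t / T" using T by (simp add: field_simps)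
    have d: "((\<lambda>t. 1 - 2 * t / T) has_real_derivative - 2 / T) (at t)"
      using T by (auto intro!: derivative_eq_intros)
    have "(F has_real_derivative - (T / (2 * (q + 1))) * ((q + 1) * (1 - 2 * t / T) powr (q + 1 - 1) * (- 2 / T))) (at t)"
      unfolding F_def by (rule DERIV_cmult[OF DERIV_chain2[OF has_real_derivative_powr[OF pos] d]])
    also have "- (T / (2 * (q + 1))) * ((q + 1) * (1 - 2 * t / T) powr (q + 1 - 1) * (- 2 / T)) = \<bar>1 - 2 * t / T\<bar> powr q"
    proof -
      have "- (T / (2 * (q + 1))) * ((q + 1) * Y * (- 2 / T)) = Y" for Y
        using T q by (simp add: divide_simps)
      then show ?thesis using pos by simp
    qed
    finally show "(F has_vector_derivative \<bar>1 - 2 * t / T\<bar> powr q) (at t)"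
      by (simp add: has_real_derivative_iff_has_vector_derivative)
  qed (use T in simp)
  then have half: "(LINT t|lebesgue_on {0..T/2}. \<bar>1 - 2 * t / T\<bar> powr q) = T / (2 * (q + 1))"
    using lebesgue_integral_eq_integral[OF continuous_imp_integrable_real[OF c]] T q
    by (simp add: integral_unique F_def)
  have "0 \<le> (LINT t|lebesgue_on {T/2..T}. \<bar>1 - 2 * t / T\<bar> powr q)" by simp
  then show ?thesis
    using integral_combine[OF continuous_imp_integrable_real[OF c], of 0 "T/2" T] half T by simp
qed

text \<open>No potential attains the infimum for \<open>p = 1\<close>; it is approached by the extremal potentials of the
  exponents \<open>p > 1\<close>, whose \<open>L\<^sup>1\<close> norms are controlled by the Hoelder inequality with \<open>u = 1\<close>.\<close>

lemma beta_ant_1_le: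
  assumes T: "0 < T"
  shows "beta_ant T 1 \<le> ereal (4 / T)"
proof -
  have le: "beta_ant T 1 \<le> ereal (4 / T * (2 * (q + 1)) powr (2 / q))" if q: "2 < q" for q :: real
  proof -
    define p where "p = (if q = 2 then \<infinity> else ereal (q / (q - 2)))"
    have p1: "1 \<le> p" "p \<noteq> 1" "p = ereal (q / (q - 2))" using q by (auto simp: p_def one_ereal_def divide_simps)
    obtain u a where u: "u \<in> X_ant_nonzero T" "\<And>w. w \<in> X_ant_nonzero T \<Longrightarrow> I_ant T p u \<le> I_ant T p w"
      and a: "a \<in> Lambda_ant T" "continuous_on UNIV a" "\<And>t. 0 \<le> a t" and norm: "Lp_norm T p a \<le> I_ant T p u"
      using minimizer_exists[OF T less_imp_le[OF q] p_def] by blast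
    define v where "v = (\<lambda>t. 1 - 2 * t / T)"
    have aT: "continuous_on {0..T} a" using a(2) by (rule continuous_on_subset) simp
    have aL: "a \<in> Lp_space T p" by (rule continuous_Lp_space[OF T p1(1) aT])
    have one: "(LINT t|lebesgue_on {0..T}. (1::real)) = T"
      using T lebesgue_integral_FTC[of 0 T "\<lambda>x. x" "\<lambda>_. 1"] by auto
    \<comment> \<open>The constant function 1 turns the weighted inequality into a comparison of the
      norms for exponents 1 and p; 2/q is 1 - 1/p.\<close>
    have den1: "I_ant_denominator T p (\<lambda>_. 1) = T powr (2 / q)"
      using I_ant_denominator_powr[OF less_imp_le[OF q] p_def, of T "\<lambda>_. 1"] one by simp
    \<comment> \<open>The minimizer for p = 1 is used as a competitor for every p > 1, so the
      unknown minimal values are bounded by an explicit expression.\<close>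
    have Ip: "I_ant T p v \<le> 4 / T * (2 * (q + 1)) powr (2 / q) / T powr (2 / q)"
    proof -
      define d where "d = (T / (2 * (q + 1))) powr (2 / q)"
      have "0 < d" using T q by (simp add: d_def)
      have "d \<le> I_ant_denominator T p v"
        unfolding I_ant_denominator_powr[OF less_imp_le[OF q] p_def] v_def d_def
        by (rule powr_mono2) (use affine_power_integral[OF T less_imp_le[OF q]] T q in auto)
      then have "4 / T / I_ant_denominator T p v \<le> 4 / T / d"
        using T \<open>0 < d\<close> by (intro divide_left_mono mult_pos_pos) auto
      then have "I_ant T p v \<le> 4 / T / (T / (2 * (q + 1))) powr (2 / q)"
        using affine_function_X_ant(2)[OF T] by (simp add: I_ant_eq v_def d_def)
      also have "\<dots> = 4 / T * (2 * (q + 1)) powr (2 / q) / T powr (2 / q)"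
        using T q by (simp add: powr_divide)
      finally show ?thesis .
    qed
    have "Lp_norm T 1 a = (LINT t|lebesgue_on {0..T}. a t * 1\<^sup>2)" using a(3) by (simp add: Lp_norm_def)
    also have "\<dots> \<le> Lp_norm T p a * I_ant_denominator T p (\<lambda>_. 1)"
      by (rule weighted_integral_le_norm_times_denominator[OF T p1(1) aL a(3) continuous_imp_integrable_real[OF aT]]) simp
    \<comment> \<open>The norm of the extremal potential is at most the minimal value, hence at most
      the value at the affine function. The power of T will cancel against the one in
      \<open>Ip\<close>.\<close>
    also have "\<dots> \<le> I_ant T p v * T powr (2 / q)"
      unfolding den1 using norm u(2)[of v] affine_function_X_ant(1)[OF T] by (intro mult_right_mono) (auto simp: v_def)
    also have "\<dots> \<le> 4 / T * (2 * (q + 1)) powr (2 / q)"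
      using mult_right_mono[OF Ip, of "T powr (2 / q)"] T by simp
    finally show ?thesis by (rule beta_ant_le[OF T _ a, rotated]) simp
  qed
  \<comment> \<open>The limit of large q is the limit p \<longlongrightarrow> 1 from above, since p
    = q/(q-2).\<close>
  have "((\<lambda>q::real. 4 / T * (2 * (q + 1)) powr (2 / q)) \<longlongrightarrow> 4 / T) at_top"
    using T by real_asymp
  then have "((\<lambda>q::real. ereal (4 / T * (2 * (q + 1)) powr (2 / q))) \<longlongrightarrow> ereal (4 / T)) at_top"
    by (intro tendsto_intros)
  then show ?thesis
    by (rule tendsto_lowerbound) (use le in \<open>auto intro!: eventually_mono[OF eventually_gt_at_top[of 2]]\<close>)
qed

theorem theorem3p1:
  fixes T :: real and p :: ereal
  assumes "0 < T" and "1 \<le> p"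
  shows "\<exists>v\<in>X_ant_nonzero T.
           (\<forall>w\<in>X_ant_nonzero T. I_ant T p v \<le> I_ant T p w) \<and> beta_ant T p = ereal (I_ant T p v)"
proof (cases "p = 1")
  case True
  note T = \<open>0 < T\<close>
  have "ereal (4 / T) \<le> beta_ant T 1" by (rule beta_ant_ge[OF T _ I_ant_1_ge[OF T]]) auto
  then have "beta_ant T 1 = ereal (4 / T)" using beta_ant_1_le[OF T] by (rule antisym[rotated])
  then show ?thesis
    unfolding True using affine_function_X_ant(1)[OF T] I_ant_1_affine[OF T] I_ant_1_ge[OF T]
    by (intro bexI[of _ "\<lambda>t. 1 - 2 * t / T"]) auto
next
  case False
  note T = \<open>0 < T\<close>
  obtain q where q: "2 \<le> q" "p = (if q = 2 then \<infinity> else ereal (q / (q - 2)))"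
  proof (cases p)
    case (real r)
    then have "1 < r" using False \<open>1 \<le> p\<close> by (auto simp: one_ereal_def)
    then show thesis using real by (intro that[of "2 * r / (r - 1)"]) (auto simp: field_simps)
  qed (use \<open>1 \<le> p\<close> in \<open>auto intro: that[of 2]\<close>)
  obtain u a where u: "u \<in> X_ant_nonzero T" "\<And>w. w \<in> X_ant_nonzero T \<Longrightarrow> I_ant T p u \<le> I_ant T p w"
    and a: "a \<in> Lambda_ant T" "continuous_on UNIV a" "\<And>t. 0 \<le> a t" "Lp_norm T p a \<le> I_ant T p u"
    using minimizer_exists[OF T q] by blast
  have "beta_ant T p = ereal (I_ant T p u)"
    using beta_ant_le[OF T \<open>1 \<le> p\<close> a] beta_ant_ge[OF T \<open>1 \<le> p\<close> u(2)] by (rule antisym)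
  then show ?thesis using u by blast
qed

end
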